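(* Let $s>0$ and let $(S(t))_{t\ge 0}$ be the semigroup of the continuous generalized KMP process with parameter $2s$ on $[0,\infty)^V$. For $\theta=(\theta_i)_{i\in V}\in(0,\infty)^V$, start this process from the product measure $\bigotimes_{i\in V}\nu_{\theta_i}$ of Gamma distributions with shape parameter $2s$ and scale parameters $\theta_i$. Then its distribution at time $t>0$ is $$\Big(\bigotimes_{i\in V}\nu_{\theta_i}\Big)S(t)\,[d\zeta]=\mathbb{E}_\theta\Big(\bigotimes_{i\in V}\nu_{\theta_i(t)}[d\zeta]\Big),$$ where $\{\theta(t),t\ge0\}$ is the hidden parameter model started from $\theta(0)=\theta$.
   Context: $V$ is a finite set, $p(i,j)=p(j,i)\ge 0$ ($i,j\in V$) are symmetric edge weights which are irreducible: any two vertices are joined by a finite path along which $p>0$. Sums $\sum_{i,j}$ run over ordered pairs of distinct vertices. $\mathrm{Beta}(2s,2s)[du]=\frac{1}{B(2s,2s)}u^{2s-1}(1-u)^{2s-1}du$ on $[0,1]$. Continuous generalized KMP process: the Markov process on $[0,\infty)^V$ with generator $Lf(\zeta)=\sum_{i,j\in V}p(i,j)L_{ij}f(\zeta)$, where $L_{ij}$ acts on the variables $(\zeta_i,\zeta_j)=(x,y)$ as $L_{ij}f(x,y)=\mathbb{E}\big(f(X(x+y),(1-X)(x+y))-f(x,y)\big)$ with $X\sim\mathrm{Beta}(2s,2s)$. Gamma distribution, $\theta>0$: $\nu_\theta[dx]=\frac{x^{2s-1}}{\theta^{2s}\Gamma(2s)}e^{-x/\theta}dx$ on $[0,\infty)$.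 Hidden parameter model: the Markov process on $[0,\infty)^V$ with generator $\mathcal{L}f(\theta)=\sum_{i,j\in V}p(i,j)\mathcal{L}_{ij}f(\theta)$, where $\mathcal{L}_{ij}$ acts on $(\theta_i,\theta_j)=(x,y)$ as $\mathcal{L}_{ij}f(x,y)=\int_0^1\big(f(xu+y(1-u),xu+y(1-u))-f(x,y)\big)\mathrm{Beta}(2s,2s)[du]$. $\mathbb{E}_\theta(\bigotimes_i\nu_{\theta_i(t)})$ is the probability measure $A\mapsto\mathbb{E}_\theta\big[(\bigotimes_i\nu_{\theta_i(t)})(A)\big]$, and $\mu S(t)$ denotes the law at time $t$ of the process started from $\mu$. *)

theory Defs
  imports "HOL-Probability.Probability"
begin

text \<open>The base measures are restricted to \<open>[0,1]\<close> and \<open>[0,\<infinity>)\<close> instead of multiplying the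
  densities by indicators: test functions on \<open>[0,\<infinity>)^V\<close> are measurable only on that set.\<close>

definition beta_law :: "real \<Rightarrow> real \<Rightarrow> real measure" where
  "beta_law a b = density (restrict_space lborel {0..1})
     (\<lambda>u. ennreal (u powr (a - 1) * (1 - u) powr (b - 1) / Beta a b))"

text \<open>Shape \<open>2 * s\<close> and scale \<open>\<theta>\<close>; a probability measure only for \<open>\<theta> > 0\<close>
  (for \<open>\<theta> = 0\<close> division by zero makes it the null measure).\<close>

definition gamma_law :: "real \<Rightarrow> real \<Rightarrow> real measure" where
  "gamma_law s \<theta> = density (restrict_space lborel {0..})
     (\<lambda>x. ennreal (x powr (2 * s - 1) / (\<theta> powr (2 * s) * Gamma (2 * s)) * exp (- x / \<theta>)))"

definition gamma_product :: "real \<Rightarrow> ('v::finite \<Rightarrow> real) \<Rightarrow> ('v \<Rightarrow> real) measure" where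
  "gamma_product s \<theta> = (\<Pi>\<^sub>M i\<in>UNIV. gamma_law s (\<theta> i))"

text \<open>The measurable space \<open>[0,\<infinity>)^V\<close>, where \<open>V\<close> is the finite type \<open>'v\<close>.\<close>

definition orthant :: "('v::finite \<Rightarrow> real) measure" where
  "orthant = (\<Pi>\<^sub>M i\<in>UNIV. restrict_space borel {0..})"

definition kmp_pair_generator ::
  "real \<Rightarrow> 'v \<Rightarrow> 'v \<Rightarrow> (('v \<Rightarrow> real) \<Rightarrow> real) \<Rightarrow> ('v \<Rightarrow> real) \<Rightarrow> real" where
  "kmp_pair_generator s i j f \<zeta> =
     (\<integral>u. f (\<zeta>(i := u * (\<zeta> i + \<zeta> j), j := (1 - u) * (\<zeta> i + \<zeta> j))) - f \<zeta>
        \<partial>beta_law (2 * s) (2 * s))"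

definition kmp_generator ::
  "real \<Rightarrow> ('v::finite \<Rightarrow> 'v \<Rightarrow> real) \<Rightarrow> (('v \<Rightarrow> real) \<Rightarrow> real) \<Rightarrow> ('v \<Rightarrow> real) \<Rightarrow> real" where
  "kmp_generator s p f \<zeta> =
     (\<Sum>i\<in>UNIV. \<Sum>j\<in>UNIV - {i}. p i j * kmp_pair_generator s i j f \<zeta>)"

definition hidden_pair_generator ::
  "real \<Rightarrow> 'v \<Rightarrow> 'v \<Rightarrow> (('v \<Rightarrow> real) \<Rightarrow> real) \<Rightarrow> ('v \<Rightarrow> real) \<Rightarrow> real" where
  "hidden_pair_generator s i j f \<theta> =
     (\<integral>u. f (\<theta>(i := \<theta> i * u + \<theta> j * (1 - u), j := \<theta> i * u + \<theta> j * (1 - u))) - f \<theta>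
        \<partial>beta_law (2 * s) (2 * s))"

definition hidden_generator ::
  "real \<Rightarrow> ('v::finite \<Rightarrow> 'v \<Rightarrow> real) \<Rightarrow> (('v \<Rightarrow> real) \<Rightarrow> real) \<Rightarrow> ('v \<Rightarrow> real) \<Rightarrow> real" where
  "hidden_generator s p f \<theta> =
     (\<Sum>i\<in>UNIV. \<Sum>j\<in>UNIV - {i}. p i j * hidden_pair_generator s i j f \<theta>)"

definition irreducible_weights :: "('v \<Rightarrow> 'v \<Rightarrow> real) \<Rightarrow> bool" where
  "irreducible_weights p \<longleftrightarrow> (\<forall>i j. (\<lambda>a b. p a b > 0)\<^sup>*\<^sup>* i j)"

definition markov_semigroup :: "'a measure \<Rightarrow> (real \<Rightarrow> 'a \<Rightarrow> 'a measure) \<Rightarrow> bool" where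
  "markov_semigroup E P \<longleftrightarrow>
     (\<forall>t\<ge>0. P t \<in> E \<rightarrow>\<^sub>M prob_algebra E) \<and>
     (\<forall>x\<in>space E. P 0 x = return E x) \<and>
     (\<forall>r\<ge>0. \<forall>t\<ge>0. \<forall>x\<in>space E. P (r + t) x = P r x \<bind> P t)"

text \<open>The generators considered have bounded jump rates, hence are bounded operators on the bounded
  measurable functions with the supremum norm; their domain is that whole space.\<close>

definition has_generator ::
  "'a measure \<Rightarrow> (real \<Rightarrow> 'a \<Rightarrow> 'a measure) \<Rightarrow> (('a \<Rightarrow> real) \<Rightarrow> 'a \<Rightarrow> real) \<Rightarrow> bool" where
  "has_generator E P L \<longleftrightarrow>
     (\<forall>f. f \<in> borel_measurable E \<and> bounded (f ` space E) \<longrightarrow>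
        uniform_limit (space E) (\<lambda>t x. ((\<integral>y. f y \<partial>P t x) - f x) / t) (L f) (at_right 0))"

definition natural_filtration ::
  "'w measure \<Rightarrow> 'a measure \<Rightarrow> (real \<Rightarrow> 'w \<Rightarrow> 'a) \<Rightarrow> real \<Rightarrow> 'w measure" where
  "natural_filtration M E X r =
     sigma (space M) {X q -` B \<inter> space M | q B. 0 \<le> q \<and> q \<le> r \<and> B \<in> sets E}"

definition markov_process ::
  "'w measure \<Rightarrow> 'a measure \<Rightarrow> (real \<Rightarrow> 'a \<Rightarrow> 'a measure) \<Rightarrow> (real \<Rightarrow> 'w \<Rightarrow> 'a) \<Rightarrow> bool" where
  "markov_process M E P X \<longleftrightarrow>
     prob_space M \<and> (\<forall>t\<ge>0. X t \<in> M \<rightarrow>\<^sub>M E) \<and>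
     (\<forall>r\<ge>0. \<forall>h\<ge>0. \<forall>A\<in>sets E. AE \<omega> in M.
        real_cond_exp M (natural_filtration M E X r) (\<lambda>\<omega>'. indicator A (X (r + h) \<omega>')) \<omega>
          = measure (P h (X r \<omega>)) A)"

end

theory Submission
  imports Defs
begin

text \<open>The Markov kernel \<open>\<theta> \<mapsto> \<Otimes>\<^sub>i \<nu>\<close> with scales \<open>\<theta>\<^sub>i\<close> intertwines
  the two generators. This concerns one pair of sites: for independent gamma variables \<open>x\<close>, \<open>y\<close>
  of scales \<open>a\<close>, \<open>b\<close>, redistributing \<open>z = x + y\<close> by a beta variable gives a mixture of products of two
  gamma laws of the common scale \<open>c = a v + b (1 - v)\<close> with \<open>v\<close> beta distributed. In the coordinates
  \<open>x = z w\<close>, \<open>y = z (1 - w)\<close>, it suffices to compare the densities of \<open>z\<close>, and these agree by the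
  substitution \<open>w = a v / c\<close>. Both generators are bounded, so the semigroups are determined by their
  Taylor expansions in \<open>t\<close>; these agree term by term.

  Terms agree only at strictly positive \<open>\<theta>\<close>, since \<open>gamma_law s 0\<close> is the null measure; the
  jumps of the hidden parameters preserve positivity.\<close>

section \<open>Semigroups with bounded generators\<close>

text \<open>Comparing the densities of \<open>z\<close> is enough because on both sides the ratio is
  beta distributed and independent of \<open>z\<close>: before averaging over \<open>v\<close>, two
  gamma variables of shape \<open>2 * s\<close> and a common scale have a
  \<open>Beta(2s, 2s)\<close> ratio independent of their sum, whatever that scale is. The failure at
  the boundary shapes the rest. The hypothesis on the generator of \<open>Q\<close> speaks only of
  functions that are bounded and measurable on the whole closed orthant, so the gamma product has to
  be a kernel there too; it is treated as a subprobability kernel. The generators are nevertheless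
  not intertwined on that space: the constant 1 is annihilated by the KMP generator, while the
  hidden generator applied to the total mass of the gamma product need not vanish at a point with a
  zero coordinate. Taylor expansions are read at a single point, so a positive \<theta> and the
  points reached from it by jumps suffice. Both expansions share one constant, twice the total rate,
  since each pair operator is a mean of \<open>f\<close> minus a value of \<open>f\<close>.\<close>

definition bounded_measurable :: "'a measure \<Rightarrow> real \<Rightarrow> ('a \<Rightarrow> real) \<Rightarrow> bool" where
  "bounded_measurable E K f \<longleftrightarrow> f \<in> borel_measurable E \<and> (\<forall>x\<in>space E. \<bar>f x\<bar> \<le> K)"

lemma bounded_measurable_integral:
  assumes "subprob_space N" and sets: "sets N = sets E" and f: "bounded_measurable E K f"
  shows "integrable N f" and "\<bar>\<integral>x. f x \<partial>N\<bar> \<le> K"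
proof -
  interpret subprob_space N by fact
  have fm: "f \<in> borel_measurable N" and fb: "\<And>x. x \<in> space N \<Longrightarrow> \<bar>f x\<bar> \<le> K"
    using f sets sets_eq_imp_space_eq[OF sets]
    by (auto simp: bounded_measurable_def cong: measurable_cong_sets)
  have "K \<ge> 0"
    using subprob_not_empty fb by force
  show int: "integrable N f"
    by (rule integrable_const_bound[where B = K]) (use fm fb in auto)
  have "\<bar>\<integral>x. f x \<partial>N\<bar> \<le> (\<integral>x. \<bar>f x\<bar> \<partial>N)"
    by (rule integral_abs_bound)
  also have "\<dots> \<le> (\<integral>x. K \<partial>N)"
    by (rule integral_mono) (use int fb in auto)
  also have "\<dots> \<le> K"
    using \<open>K \<ge> 0\<close> subprob_measure_le_1[of "space N"] by (simp add: mult_left_le_one_le)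
  finally show "\<bar>\<integral>x. f x \<partial>N\<bar> \<le> K" .
qed

text \<open>\<open>C\<close> bounds the norm of \<open>L\<close>. The bound is phrased through
  \<open>bounded_measurable\<close> so that its conclusion is again a premise for the next
  iterate.\<close>

locale generated_semigroup =
  fixes E :: "'a measure" and P :: "real \<Rightarrow> 'a \<Rightarrow> 'a measure"
    and L :: "('a \<Rightarrow> real) \<Rightarrow> 'a \<Rightarrow> real" and C :: real
  assumes semigroup: "markov_semigroup E P"
    and generator: "has_generator E P L"
    and bound: "\<And>K f. bounded_measurable E K f \<Longrightarrow> bounded_measurable E (C * K) (L f)"
begin

lemma measurable_kernel: "t \<ge> 0 \<Longrightarrow> P t \<in> E \<rightarrow>\<^sub>M prob_algebra E"
  using semigroup by (auto simp: markov_semigroup_def)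

lemma
  assumes "t \<ge> 0" "x \<in> space E"
  shows prob_kernel: "prob_space (P t x)" and sets_kernel: "sets (P t x) = sets E"
    and space_kernel: "space (P t x) = space E"
proof -
  have "P t x \<in> space (prob_algebra E)"
    by (rule measurable_space[OF measurable_kernel[OF assms(1)] assms(2)])
  then show "prob_space (P t x)" and "sets (P t x) = sets E"
    by (simp_all add: space_prob_algebra)
  then show "space (P t x) = space E"
    by (intro sets_eq_imp_space_eq)
qed

lemma
  assumes "t \<ge> 0" "x \<in> space E" "bounded_measurable E K f"
  shows integrable_kernel: "integrable (P t x) f"
    and integral_kernel_bound: "\<bar>\<integral>y. f y \<partial>P t x\<bar> \<le> K"
  by (rule bounded_measurable_integral[OF prob_space_imp_subprob_space[OF prob_kernel] sets_kernel],
      fact+)+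

lemma bounded_measurable_kernel:
  assumes "t \<ge> 0" and f: "bounded_measurable E K f"
  shows "bounded_measurable E K (\<lambda>x. \<integral>y. f y \<partial>P t x)"
proof -
  have [measurable]: "f \<in> borel_measurable E"
    using f by (simp add: bounded_measurable_def)
  note [measurable] = measurable_prob_algebraD[OF measurable_kernel[OF assms(1)]]
  have "(\<lambda>x. \<integral>y. f y \<partial>P t x) \<in> borel_measurable E"
    by measurable
  then show ?thesis
    using integral_kernel_bound[OF assms(1) _ f] by (auto simp: bounded_measurable_def)
qed

section \<open>Time derivatives of the semigroup\<close>

lemma integral_kernel_add:
  assumes r: "r \<ge> 0" and t: "t \<ge> 0" and x: "x \<in> space E" and f: "bounded_measurable E K f"
  shows "(\<integral>y. f y \<partial>P (r + t) x) = (\<integral>y. \<integral>z. f z \<partial>P t y \<partial>P r x)"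
proof -
  have fm: "f \<in> borel_measurable E" and fb: "\<And>x. x \<in> space E \<Longrightarrow> \<bar>f x\<bar> \<le> K"
    using f by (auto simp: bounded_measurable_def)
  have "P (r + t) x = P r x \<bind> P t"
    using semigroup r t x by (simp add: markov_semigroup_def)
  moreover have "(\<integral>y. f y \<partial>(P r x \<bind> P t)) = (\<integral>y. \<integral>z. f z \<partial>P t y \<partial>P r x)"
  proof (rule integral_bind[where K = E and B = K and B' = 1])
    interpret prob_space "P r x" by (rule prob_kernel[OF r x])
    show "finite_measure (P r x)" by unfold_locales
    show "P t \<in> P r x \<rightarrow>\<^sub>M subprob_algebra E"
      using measurable_prob_algebraD[OF measurable_kernel[OF t]] sets_kernel[OF r x]
      by (simp cong: measurable_cong_sets)
    show "AE y in P r x. emeasure (P t y) (space (P t y)) \<le> ennreal 1"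
      using prob_space.emeasure_space_1[OF prob_kernel[OF t]] space_kernel[OF r x]
      by (intro AE_I2) simp
  qed (use fm fb in auto)
  ultimately show ?thesis by simp
qed

text \<open>The threshold \<open>d\<close> does not depend on \<open>x\<close>, because the
  generator is a uniform limit. Hence the estimate can later be integrated against
  \<open>P r x\<close>.\<close>

lemma integral_kernel_increment:
  assumes f: "bounded_measurable E K f" and "e > 0"
  obtains d where "d > 0"
    and "\<And>h x. \<lbrakk>0 < h; h < d; x \<in> space E\<rbrakk>
           \<Longrightarrow> \<bar>(\<integral>y. f y \<partial>P h x) - f x - h * L f x\<bar> \<le> e * h"
proof -
  have "bounded (f ` space E)"
    using f by (auto simp: bounded_measurable_def bounded_iff)
  then have "uniform_limit (space E) (\<lambda>t x. ((\<integral>y. f y \<partial>P t x) - f x) / t) (L f) (at_right 0)"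
    using generator f by (simp add: has_generator_def bounded_measurable_def)
  then have "\<forall>\<^sub>F h in at_right 0. \<forall>x\<in>space E. \<bar>((\<integral>y. f y \<partial>P h x) - f x) / h - L f x\<bar> < e"
    using \<open>e > 0\<close> by (auto simp: uniform_limit_iff dist_real_def)
  then obtain d where "d > 0"
    and d: "\<And>h x. \<lbrakk>0 < h; h < d; x \<in> space E\<rbrakk> \<Longrightarrow> \<bar>((\<integral>y. f y \<partial>P h x) - f x) / h - L f x\<bar> < e"
    unfolding eventually_at_right_field by auto
  show thesis
  proof (rule that[OF \<open>d > 0\<close>])
    fix h x assume h: "0 < h" "h < d" "x \<in> space E"
    have "(\<integral>y. f y \<partial>P h x) - f x - h * L f x = (((\<integral>y. f y \<partial>P h x) - f x) / h - L f x) * h"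
      using h(1) by (simp add: field_simps)
    then have "\<bar>(\<integral>y. f y \<partial>P h x) - f x - h * L f x\<bar>
        = \<bar>((\<integral>y. f y \<partial>P h x) - f x) / h - L f x\<bar> * \<bar>h\<bar>"
      by (simp only: abs_mult)
    also have "\<dots> \<le> e * \<bar>h\<bar>"
      using d[OF h] by (intro mult_right_mono) auto
    finally show "\<bar>(\<integral>y. f y \<partial>P h x) - f x - h * L f x\<bar> \<le> e * h" using h(1) by simp
  qed
qed

text \<open>The coefficient \<open>c\<close> is left free for two uses: \<open>c = h\<close> with
  \<open>g = L f\<close> yields the derivative, \<open>c = 0\<close> the strong continuity.\<close>

lemma bounded_measurable_increment:
  assumes f: "bounded_measurable E K f" and g: "bounded_measurable E K' g" and "h \<ge> 0"
    and "\<And>x. x \<in> space E \<Longrightarrow> \<bar>(\<integral>y. f y \<partial>P h x) - f x - c * g x\<bar> \<le> B"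
  shows "bounded_measurable E B (\<lambda>x. (\<integral>y. f y \<partial>P h x) - f x - c * g x)"
  using bounded_measurable_kernel[OF assms(3) f] f g assms(4)
  by (auto simp: bounded_measurable_def)

lemma integral_increment:
  assumes f: "bounded_measurable E K f" and g: "bounded_measurable E K' g"
    and "r \<ge> 0" "h \<ge> 0" and x: "x \<in> space E"
  shows "(\<integral>y. (\<integral>z. f z \<partial>P h y) - f y - c * g y \<partial>P r x)
           = (\<integral>y. f y \<partial>P (r + h) x) - (\<integral>y. f y \<partial>P r x) - c * (\<integral>y. g y \<partial>P r x)"
  using integrable_kernel[OF \<open>r \<ge> 0\<close> x f] integrable_kernel[OF \<open>r \<ge> 0\<close> x g]
    integrable_kernel[OF \<open>r \<ge> 0\<close> x bounded_measurable_kernel[OF \<open>h \<ge> 0\<close> f]]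
  by (simp add: integral_kernel_add[OF \<open>r \<ge> 0\<close> \<open>h \<ge> 0\<close> x f])

text \<open>Only the right derivative is immediate. For the left one, \<open>P r\<close> is factored out of
  \<open>P t - P r\<close> at the earlier time \<open>r\<close>, and the strong continuity of \<open>P\<close> moves
  \<open>P r (L f)\<close> to \<open>P t (L f)\<close>.\<close>

lemma has_field_derivative_kernel:
  assumes f: "bounded_measurable E K f" and t: "t \<ge> 0" and x: "x \<in> space E"
  shows "((\<lambda>r. \<integral>y. f y \<partial>P r x) has_field_derivative (\<integral>y. L f y \<partial>P t x)) (at t within {0..})"
  unfolding has_field_derivative_def has_derivative_within_alt
proof (intro conjI allI impI)
  show "bounded_linear ((*) (\<integral>y. L f y \<partial>P t x))"
    by (rule bounded_linear_mult_right)
  fix e :: real assume "e > 0"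
  note Lf = bound[OF f]
  let ?T = "\<lambda>r f. \<integral>y. f y \<partial>P r x"
  have K: "0 \<le> C * (C * K)"
    using bound[OF Lf] x by (force simp: bounded_measurable_def)
  obtain d1 where "d1 > 0"
    and d1: "\<And>h x. \<lbrakk>0 < h; h < d1; x \<in> space E\<rbrakk>
                  \<Longrightarrow> \<bar>(\<integral>y. f y \<partial>P h x) - f x - h * L f x\<bar> \<le> e / 2 * h"
    using integral_kernel_increment[OF f, of "e / 2"] \<open>e > 0\<close> by auto
  obtain d2 where "d2 > 0"
    and d2: "\<And>h x. \<lbrakk>0 < h; h < d2; x \<in> space E\<rbrakk>
                  \<Longrightarrow> \<bar>(\<integral>y. L f y \<partial>P h x) - L f x - h * L (L f) x\<bar> \<le> 1 * h"
    using integral_kernel_increment[OF Lf, of 1] by auto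
  \<comment> \<open>\<open>h * D\<close> bounds the increment of \<open>L f\<close> over time
    \<open>h\<close>: the error term gives \<open>1 * h\<close>, the linear term
    \<open>h * L (L f) x\<close> at most \<open>h * (C * (C * K))\<close>. For \<open>h < d\<close>
    this is at most \<open>e / 2\<close>.\<close>
  define D where "D = 1 + C * (C * K)"
  have "D > 0" using K by (simp add: D_def)
  define d where "d = min (min d1 d2) (e / 2 / D)"
  have "d > 0"
    using \<open>d1 > 0\<close> \<open>d2 > 0\<close> \<open>e > 0\<close> \<open>D > 0\<close> by (simp add: d_def)
  have main: "\<bar>?T (r + h) f - ?T r f - h * ?T r (L f)\<bar> \<le> e / 2 * h"
    if "r \<ge> 0" "0 < h" "h < d" for r h
  proof -
    have "bounded_measurable E (e / 2 * h) (\<lambda>x. (\<integral>y. f y \<partial>P h x) - f x - h * L f x)"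
      using that d1 by (intro bounded_measurable_increment[OF f Lf]) (auto simp: d_def)
    from integral_kernel_bound[OF \<open>r \<ge> 0\<close> x this] show ?thesis
      using that by (simp add: integral_increment[OF f Lf _ _ x])
  qed
  have cont: "\<bar>?T (r + h) (L f) - ?T r (L f)\<bar> \<le> e / 2" if "r \<ge> 0" "0 < h" "h < d" for r h
  proof -
    have "\<bar>(\<integral>y. L f y \<partial>P h x) - L f x - 0 * L f x\<bar> \<le> e / 2" if x: "x \<in> space E" for x
    proof -
      have "h * \<bar>L (L f) x\<bar> \<le> h * (C * (C * K))"
        using bound[OF Lf] x \<open>0 < h\<close> by (auto simp: bounded_measurable_def)
      then have "\<bar>h * L (L f) x\<bar> \<le> h * (C * (C * K))"
        using \<open>0 < h\<close> by (simp add: abs_mult)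
      moreover have "\<bar>(\<integral>y. L f y \<partial>P h x) - L f x - h * L (L f) x\<bar> \<le> 1 * h"
        using d2 \<open>0 < h\<close> \<open>h < d\<close> x by (simp add: d_def)
      ultimately have "\<bar>(\<integral>y. L f y \<partial>P h x) - L f x\<bar> \<le> h * D"
        by (simp add: D_def algebra_simps)
      also have "\<dots> \<le> e / 2 / D * D"
        using \<open>h < d\<close> \<open>D > 0\<close> by (intro mult_right_mono) (auto simp: d_def)
      also have "\<dots> = e / 2" using \<open>D > 0\<close> by simp
      finally show ?thesis by simp
    qed
    then have "bounded_measurable E (e / 2) (\<lambda>x. (\<integral>y. L f y \<partial>P h x) - L f x - 0 * L f x)"
      using \<open>0 < h\<close> by (intro bounded_measurable_increment[OF Lf Lf]) auto
    from integral_kernel_bound[OF \<open>r \<ge> 0\<close> x this] show ?thesis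
      using that by (simp only: integral_increment[OF Lf Lf _ _ x] less_imp_le)
  qed
  show "\<exists>d>0. \<forall>y\<in>{0..}. norm (y - t) < d \<longrightarrow>
          norm (?T y f - ?T t f - ?T t (L f) * (y - t)) \<le> e * norm (y - t)"
  proof (intro exI conjI ballI impI)
    show "d > 0" by fact
    fix y :: real assume y: "y \<in> {0..}" "norm (y - t) < d"
    consider "y = t" | "y > t" | "y < t" by linarith
    then show "norm (?T y f - ?T t f - ?T t (L f) * (y - t)) \<le> e * norm (y - t)"
    proof cases
      case 2
      have "\<bar>?T y f - ?T t f - (y - t) * ?T t (L f)\<bar> \<le> e / 2 * (y - t)"
        using main[of t "y - t"] t 2 y by simp
      also have "\<dots> \<le> e * (y - t)" using \<open>e > 0\<close> 2 by simp
      finally show ?thesis using 2 by (simp add: mult.commute)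
    next
      case 3
      have "\<bar>?T t f - ?T y f - (t - y) * ?T y (L f)\<bar> \<le> e / 2 * (t - y)"
        using main[of y "t - y"] t 3 y by simp
      moreover have "\<bar>(t - y) * (?T t (L f) - ?T y (L f))\<bar> \<le> (t - y) * (e / 2)"
        using cont[of y "t - y"] t 3 y by (simp add: abs_mult)
      moreover have "?T y f - ?T t f - (y - t) * ?T t (L f)
          = (t - y) * (?T t (L f) - ?T y (L f)) - (?T t f - ?T y f - (t - y) * ?T y (L f))"
        by (simp add: algebra_simps)
      moreover have "e / 2 * (t - y) + (t - y) * (e / 2) = e * (t - y)"
        by (simp add: algebra_simps)
      ultimately have "\<bar>?T y f - ?T t f - (y - t) * ?T t (L f)\<bar> \<le> e * (t - y)"
        by linarith
      then show ?thesis using 3 by (simp add: mult.commute)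
    qed simp
  qed
qed

section \<open>Taylor expansion of the semigroup\<close>

lemma bounded_measurable_funpow:
  "bounded_measurable E K f \<Longrightarrow> bounded_measurable E (C ^ n * K) ((L ^^ n) f)"
proof (induction n)
  case (Suc n)
  then show ?case
    using bound[of "C ^ n * K" "(L ^^ n) f"] by (simp add: mult.assoc)
qed simp

text \<open>The \<open>i\<close>-th time derivative of the mean of \<open>f\<close> is the mean of
  \<open>(L ^^ i) f\<close>, and \<open>P 0 x\<close> is the point mass at \<open>x\<close>. The
  derivatives are one-sided at 0, hence the set \<open>{0..}\<close>. The remainder carries
  \<open>fact n\<close>, as in the field version of Taylor's bound; it still tends to 0.\<close>

lemma kernel_taylor:
  assumes f: "bounded_measurable E K f" and t: "t \<ge> 0" and x: "x \<in> space E"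
  shows "\<bar>(\<integral>y. f y \<partial>P t x) - (\<Sum>i\<le>n. (L ^^ i) f x * t ^ i / fact i)\<bar>
           \<le> C ^ Suc n * K * t ^ Suc n / fact n"
proof -
  have P0: "(\<integral>y. (L ^^ i) f y \<partial>P 0 x) = (L ^^ i) f x" for i
    using semigroup x bounded_measurable_funpow[OF f, of i]
    by (simp add: markov_semigroup_def bounded_measurable_def integral_return)
  have "norm ((\<integral>y. (L ^^ 0) f y \<partial>P t x)
          - (\<Sum>i\<le>n. (\<integral>y. (L ^^ i) f y \<partial>P 0 x) * (t - 0) ^ i / fact i))
        \<le> C ^ Suc n * K * norm (t - 0) ^ Suc n / fact n"
  proof (rule field_Taylor[where S = "{0..}"])
    show "((\<lambda>r. \<integral>y. (L ^^ i) f y \<partial>P r x) has_field_derivative (\<integral>y. (L ^^ Suc i) f y \<partial>P r x))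
            (at r within {0..})" if "r \<in> {0..}" for i r
      using has_field_derivative_kernel[OF bounded_measurable_funpow[OF f, of i] _ x] that by simp
    show "norm (\<integral>y. (L ^^ Suc n) f y \<partial>P r x) \<le> C ^ Suc n * K" if "r \<in> {0..}" for r
      using integral_kernel_bound[OF _ x bounded_measurable_funpow[OF f, of "Suc n"]] that by simp
  qed (use t in auto)
  then show ?thesis using t by (simp add: P0)
qed

end

section \<open>Redistribution of a pair of gamma variables\<close>

text \<open>The density as a real function on the whole line, so that it is Borel measurable jointly
  in scale and argument. The scale has to be a variable here because it is integrated over
  later.\<close>

definition gamma_weight :: "real \<Rightarrow> real \<Rightarrow> real \<Rightarrow> real" where
  "gamma_weight s \<theta> x = x powr (2 * s - 1) / (\<theta> powr (2 * s) * Gamma (2 * s)) * exp (- x / \<theta>)"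

definition beta_weight :: "real \<Rightarrow> real \<Rightarrow> real" where
  "beta_weight s u = u powr (2 * s - 1) * (1 - u) powr (2 * s - 1) / Beta (2 * s) (2 * s)"

lemma measurable_gamma_weight [measurable (raw)]:
  assumes [measurable]: "f \<in> borel_measurable M" "g \<in> borel_measurable M"
  shows "(\<lambda>x. gamma_weight s (f x) (g x)) \<in> borel_measurable M"
  unfolding gamma_weight_def by measurable

lemma measurable_beta_weight [measurable (raw)]:
  assumes [measurable]: "f \<in> borel_measurable M"
  shows "(\<lambda>x. beta_weight s (f x)) \<in> borel_measurable M"
  unfolding beta_weight_def by measurable

lemma gamma_weight_nonneg: "s > 0 \<Longrightarrow> 0 \<le> gamma_weight s \<theta> x"
  unfolding gamma_weight_def using Gamma_real_pos[of "2 * s"] by simp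

lemma Beta_real_pos: "a > 0 \<Longrightarrow> b > 0 \<Longrightarrow> Beta a b > (0 :: real)"
  unfolding Beta_def using Gamma_real_pos[of a] Gamma_real_pos[of b] Gamma_real_pos[of "a + b"] by simp

lemma beta_weight_nonneg: "s > 0 \<Longrightarrow> 0 \<le> beta_weight s u"
  unfolding beta_weight_def using Beta_real_pos[of "2 * s" "2 * s"] by simp

text \<open>Moves the integral to \<open>lborel\<close> on the whole line, where Tonelli and affine
  substitutions apply, while \<open>f\<close> stays measurable on the half-line only.\<close>

lemma nn_integral_gamma_law:
  assumes [measurable]: "f \<in> borel_measurable (restrict_space borel {0..})"
  shows "(\<integral>\<^sup>+x. f x \<partial>gamma_law s \<theta>)
           = (\<integral>\<^sup>+x. ennreal (gamma_weight s \<theta> x) * f x * indicator {0..} x \<partial>lborel)"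
  unfolding gamma_law_def gamma_weight_def[symmetric]
  by (subst nn_integral_density, measurable)
     (use assms in \<open>simp_all add: nn_integral_restrict_space measurable_restrict_space1
        cong: measurable_cong_sets sets_restrict_space_cong\<close>)

lemma nn_integral_beta_law:
  assumes [measurable]: "f \<in> borel_measurable (restrict_space borel {0..1})"
  shows "(\<integral>\<^sup>+u. f u \<partial>beta_law (2 * s) (2 * s))
           = (\<integral>\<^sup>+u. ennreal (beta_weight s u) * f u * indicator {0..1} u \<partial>lborel)"
  unfolding beta_law_def beta_weight_def[symmetric]
  by (subst nn_integral_density, measurable)
     (use assms in \<open>simp_all add: nn_integral_restrict_space measurable_restrict_space1
        cong: measurable_cong_sets sets_restrict_space_cong\<close>)

section \<open>Total masses of the two laws\<close>

lemma sets_gamma_law: "sets (gamma_law s \<theta>) = sets (restrict_space borel {0..})"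
  unfolding gamma_law_def by (simp cong: sets_restrict_space_cong)

lemma space_gamma_law: "space (gamma_law s \<theta>) = {0..}"
  unfolding gamma_law_def by (simp add: space_restrict_space)

lemma sets_beta_law: "sets (beta_law a b) = sets (restrict_space borel {0..1})"
  unfolding beta_law_def by (simp cong: sets_restrict_space_cong)

lemma space_beta_law: "space (beta_law a b) = {0..1}"
  unfolding beta_law_def by (simp add: space_restrict_space)

lemma prob_space_beta_law:
  assumes "s > 0"
  shows "prob_space (beta_law (2 * s) (2 * s))"
proof (rule prob_spaceI)
  have "((\<lambda>u. beta_weight s u) has_integral Beta (2 * s) (2 * s) / Beta (2 * s) (2 * s)) {0..1}"
    unfolding beta_weight_def
    using has_integral_Beta_real[of "2 * s" "2 * s"] assms by (intro has_integral_divide) auto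
  then have "((\<lambda>u. beta_weight s u) has_integral 1) {0..1}"
    using Beta_real_pos[of "2 * s" "2 * s"] assms by simp
  from nn_integral_has_integral_lebesgue'[OF _ this] beta_weight_nonneg[OF assms]
  have "(\<integral>\<^sup>+u. ennreal (beta_weight s u) * 1 * indicator {0..1} u \<partial>lborel) = 1"
    by simp
  then show "emeasure (beta_law (2 * s) (2 * s)) (space (beta_law (2 * s) (2 * s))) = 1"
    using nn_integral_beta_law[of "\<lambda>_. 1" s] by simp
qed

lemma prob_space_gamma_law:
  assumes "s > 0" "\<theta> > 0"
  shows "prob_space (gamma_law s \<theta>)"
proof (rule prob_spaceI)
  have \<Gamma>: "Gamma (2 * s) \<noteq> 0"
    using assms by (intro less_imp_neq[THEN not_sym]) simp
  \<comment> \<open>Rescaling by \<theta> turns the density into the integrand of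
    \<open>Gamma (2 * s)\<close>. The summand 0 is kept to match the affine substitution with
    \<open>t = 0\<close>.\<close>
  have "ennreal (gamma_weight s \<theta> (0 + \<theta> * x)) * indicator {0..} (0 + \<theta> * x)
      = ennreal (1 / (\<theta> * Gamma (2 * s))) * ennreal (indicator {0..} x * x powr (2 * s - 1) / exp x)"
    for x
    using assms \<Gamma> powr_add[of \<theta> "2 * s - 1" 1]
    by (auto simp: gamma_weight_def powr_mult indicator_def exp_minus ennreal_mult'[symmetric]
        zero_le_mult_iff field_simps)
  then have "(\<integral>\<^sup>+x. ennreal (gamma_weight s \<theta> x) * indicator {0..} x \<partial>lborel)
      = ennreal \<theta> * (\<integral>\<^sup>+x. ennreal (1 / (\<theta> * Gamma (2 * s)))
                         * ennreal (indicator {0..} x * x powr (2 * s - 1) / exp x) \<partial>lborel)"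
    using assms by (subst nn_integral_real_affine[where c = \<theta> and t = 0]) auto
  also have "\<dots> = ennreal \<theta> * (ennreal (1 / (\<theta> * Gamma (2 * s))) * ennreal (Gamma (2 * s)))"
    using assms by (subst nn_integral_cmult) (auto simp: Gamma_conv_nn_integral_real)
  also have "\<dots> = 1"
    using assms \<Gamma> by (simp add: ennreal_mult'[symmetric])
  finally have "(\<integral>\<^sup>+x. ennreal (gamma_weight s \<theta> x) * 1 * indicator {0..} x \<partial>lborel) = 1"
    by simp
  then show "emeasure (gamma_law s \<theta>) (space (gamma_law s \<theta>)) = 1"
    using nn_integral_gamma_law[of "\<lambda>_. 1" s \<theta>] by simp
qed

text \<open>The factor \<open>z\<close> is the Jacobian of \<open>(z, w)\<close> to
  \<open>(z * w, z * (1 - w))\<close>. The map is split into two affine substitutions in one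
  variable, \<open>y = z - x\<close> for fixed \<open>x\<close> and \<open>x = z * w\<close> for
  fixed \<open>z\<close>, with Tonelli in between.\<close>

lemma nn_integral_quadrant_sum_ratio:
  fixes G :: "real \<Rightarrow> real \<Rightarrow> ennreal"
  assumes [measurable]: "(\<lambda>(x, y). G x y) \<in> borel_measurable (borel \<Otimes>\<^sub>M borel)"
  shows "(\<integral>\<^sup>+x. \<integral>\<^sup>+y. G x y * indicator {0..} x * indicator {0..} y \<partial>lborel \<partial>lborel)
       = (\<integral>\<^sup>+z. \<integral>\<^sup>+w. G (z * w) (z * (1 - w)) * ennreal z * indicator {0..} z * indicator {0..1} w
            \<partial>lborel \<partial>lborel)"
proof -
  have "(\<integral>\<^sup>+x. \<integral>\<^sup>+y. G x y * indicator {0..} x * indicator {0..} y \<partial>lborel \<partial>lborel)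
      = (\<integral>\<^sup>+x. \<integral>\<^sup>+z. G x (z - x) * indicator {0..} x * indicator {0..} (z - x) \<partial>lborel \<partial>lborel)"
    by (rule nn_integral_cong, subst nn_integral_real_affine[where c = 1 and t = "- x" for x])
       simp_all
  also have "\<dots> = (\<integral>\<^sup>+z. \<integral>\<^sup>+x. G x (z - x) * indicator {0..} x * indicator {0..} (z - x) \<partial>lborel \<partial>lborel)"
    by (rule lborel_pair.Fubini'[symmetric]) measurable
  also have "\<dots> = (\<integral>\<^sup>+z. \<integral>\<^sup>+w. G (z * w) (z * (1 - w)) * ennreal z * indicator {0..} z
                              * indicator {0..1} w \<partial>lborel \<partial>lborel)"
  proof (rule nn_integral_cong_AE)
    \<comment> \<open>The substitution \<open>x = z * w\<close> degenerates at \<open>z = 0\<close>,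
      which is a null set.\<close>
    have "(\<integral>\<^sup>+x. G x (z - x) * indicator {0..} x * indicator {0..} (z - x) \<partial>lborel)
        = (\<integral>\<^sup>+w. G (z * w) (z * (1 - w)) * ennreal z * indicator {0..} z * indicator {0..1} w \<partial>lborel)"
      if "z \<noteq> 0" for z
    proof (cases "z > 0")
      case True
      have "(\<integral>\<^sup>+x. G x (z - x) * indicator {0..} x * indicator {0..} (z - x) \<partial>lborel)
          = ennreal z * (\<integral>\<^sup>+w. G (0 + z * w) (z - (0 + z * w)) * indicator {0..} (0 + z * w)
                              * indicator {0..} (z - (0 + z * w)) \<partial>lborel)"
        using True by (subst nn_integral_real_affine[where c = z and t = 0]) simp_all
      also have "\<dots> = (\<integral>\<^sup>+w. ennreal z * (G (0 + z * w) (z - (0 + z * w)) * indicator {0..} (0 + z * w)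
                              * indicator {0..} (z - (0 + z * w))) \<partial>lborel)"
        by (rule nn_integral_cmult[symmetric]) measurable
      also have "\<dots> = (\<integral>\<^sup>+w. G (z * w) (z * (1 - w)) * ennreal z * indicator {0..} z
                            * indicator {0..1} w \<partial>lborel)"
        using True
        by (intro nn_integral_cong)
           (auto simp: indicator_def zero_le_mult_iff right_diff_distrib mult_ac)
      finally show ?thesis .
    next
      \<comment> \<open>For \<open>z < 0\<close> no \<open>x\<close> satisfies
        \<open>0 \<le> x\<close> and \<open>x \<le> z\<close>, so both sides vanish.\<close>
      case False
      have "(\<integral>\<^sup>+x. G x (z - x) * indicator {0..} x * indicator {0..} (z - x) \<partial>lborel) = (\<integral>\<^sup>+x. 0 \<partial>(lborel :: real measure))"
        using False that by (intro nn_integral_cong) (auto simp: indicator_def)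
      then show ?thesis using False that by simp
    qed
    then show "AE z in lborel. (\<integral>\<^sup>+x. G x (z - x) * indicator {0..} x * indicator {0..} (z - x) \<partial>lborel)
        = (\<integral>\<^sup>+w. G (z * w) (z * (1 - w)) * ennreal z * indicator {0..} z * indicator {0..1} w \<partial>lborel)"
      using AE_lborel_singleton[of 0] by (rule_tac eventually_mono) auto
  qed
  finally show ?thesis .
qed

text \<open>With the common Jacobian \<open>z\<close> left out, both sides are joint densities of
  the sum \<open>z\<close> and the ratio \<open>u\<close>. For equal scales the product of gamma
  weights depends on \<open>u\<close> only through
  \<open>u powr (2 * s - 1) * (1 - u) powr (2 * s - 1)\<close>, so \<open>u\<close> cancels and an
  identity between densities of \<open>z\<close> remains.\<close>

lemma gamma_pair_weight_mixture:
  assumes s: "s > 0" and a: "a > 0" and b: "b > 0" and z: "z > 0" and u: "u \<in> {0..1}"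
  shows "(\<integral>\<^sup>+w. ennreal (gamma_weight s a (z * w) * gamma_weight s b (z * (1 - w)) * beta_weight s u)
              * indicator {0..1} w \<partial>lborel)
       = (\<integral>\<^sup>+v. ennreal (beta_weight s v * gamma_weight s (a * v + b * (1 - v)) (z * u)
              * gamma_weight s (a * v + b * (1 - v)) (z * (1 - u))) * indicator {0..1} v \<partial>lborel)"
proof -
  text \<open>The substitution \<open>w = a v / c v\<close> is chosen so that \<open>w / a + (1 - w) / b = 1 / c v\<close>.\<close>
  define c where "c v = a * v + b * (1 - v)" for v
  define g where "g v = a * v / c v" for v
  define f where "f w = gamma_weight s a (z * w) * gamma_weight s b (z * (1 - w)) * beta_weight s u" for w
  have c: "c v > 0" if "v \<in> {0..1}" for v
  proof (cases "v = 0")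
    case False
    then have "a * v > 0" "b * (1 - v) \<ge> 0" using that a b by auto
    then show ?thesis by (simp add: c_def)
  qed (simp add: c_def b)
  have g01: "g 0 = 0" "g 1 = 1" using a by (auto simp: g_def c_def)
  have "(\<integral>\<^sup>+w. ennreal (f w) * indicator {g 0..g 1} w \<partial>lborel)
      = (\<integral>\<^sup>+v. ennreal (f (g v) * (a * b / (c v)\<^sup>2)) * indicator {0..1} v \<partial>lborel)"
  proof -
    have "(\<integral>\<^sup>+w. ennreal (f w * indicator {g 0..g 1} w) \<partial>lborel)
        = (\<integral>\<^sup>+v. ennreal (f (g v) * (a * b / (c v)\<^sup>2) * indicator {0..1} v) \<partial>lborel)"
    proof (rule nn_integral_substitution)
      have [measurable]: "f \<in> borel_measurable borel"
        unfolding f_def by measurable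
      show "set_borel_measurable borel {g 0..g 1} f"
        unfolding set_borel_measurable_def by measurable
      \<comment> \<open>The numerator \<open>a * c v - a * v * (a - b)\<close> of the quotient rule
        collapses to \<open>a * b\<close>. It is positive, so \<open>g\<close> increases from 0 to
        1.\<close>
      show "(g has_real_derivative a * b / (c v)\<^sup>2) (at v)" if "v \<in> {0..1}" for v
        unfolding g_def c_def
        by (rule derivative_eq_intros refl | use c[OF that] in \<open>force simp: c_def\<close>)+
           (use c[OF that] in \<open>simp add: c_def field_simps power2_eq_square\<close>)
      show "continuous_on {0..1} (\<lambda>v. a * b / (c v)\<^sup>2)"
        unfolding c_def by (intro continuous_intros) (use c in \<open>force simp: c_def\<close>)
    qed (use a b in auto)
    moreover have "ennreal (x * indicator A y) = ennreal x * indicator A y" for x y and A :: "real set"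
      by (simp add: indicator_def)
    ultimately show ?thesis by (simp only:)
  qed
  also have "\<dots> = (\<integral>\<^sup>+v. ennreal (beta_weight s v * gamma_weight s (c v) (z * u)
                     * gamma_weight s (c v) (z * (1 - u))) * indicator {0..1} v \<partial>lborel)"
  proof (intro nn_integral_cong)
    fix v :: real
    show "ennreal (f (g v) * (a * b / (c v)\<^sup>2)) * indicator {0..1} v
        = ennreal (beta_weight s v * gamma_weight s (c v) (z * u)
                     * gamma_weight s (c v) (z * (1 - u))) * indicator {0..1} v"
    proof (cases "v \<in> {0..1}")
      case True
      note cv = c[OF True]
      have g': "1 - g v = b * (1 - v) / c v"
        using cv by (simp add: g_def field_simps) (simp add: c_def algebra_simps)
      have "z * g v / a + z * (1 - g v) / b = z / c v * (v + (1 - v))"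
        unfolding g' unfolding g_def using cv a b by (simp add: field_simps)
      then have e: "exp (- (z * g v) / a) * exp (- (z * (1 - g v)) / b)
          = exp (- (z * u) / c v) * exp (- (z * (1 - u)) / c v)"
        using cv by (simp add: exp_add[symmetric] diff_divide_distrib algebra_simps)
      \<comment> \<open>Writing \<open>x powr (2 * s)\<close> as \<open>x powr k * x\<close>
        isolates the powers that do not cancel by themselves: the surplus \<open>a * b\<close>
        cancels against the derivative of \<open>g\<close>, whose denominator
        \<open>(c v)\<^sup>2\<close> supplies the surplus of the two scales
        \<open>c v\<close>.\<close>
      define k where "k = 2 * s - 1"
      have p1: "x powr (2 * s) = x powr k * x" if "x > 0" for x
        using that powr_add[of x k 1] by (simp add: k_def)
      have p: "(z * g v) powr k = z powr k * a powr k * v powr k / c v powr k"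
        "(z * (1 - g v)) powr k = z powr k * b powr k * (1 - v) powr k / c v powr k"
        "(z * u) powr k = z powr k * u powr k"
        "(z * (1 - u)) powr k = z powr k * (1 - u) powr k"
        unfolding g' using True cv a b z u by (simp_all add: g_def powr_mult powr_divide)
      have "f (g v) * (a * b / (c v)\<^sup>2)
          = (z powr k * a powr k * v powr k / c v powr k) / (a powr (2 * s) * Gamma (2 * s))
            * ((z powr k * b powr k * (1 - v) powr k / c v powr k) / (b powr (2 * s) * Gamma (2 * s)))
            * (exp (- (z * g v) / a) * exp (- (z * (1 - g v)) / b))
            * beta_weight s u * (a * b / (c v)\<^sup>2)"
        by (simp add: f_def gamma_weight_def k_def[symmetric] p)
      also have "\<dots> = beta_weight s v * gamma_weight s (c v) (z * u) * gamma_weight s (c v) (z * (1 - u))"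
        unfolding e using cv a b
        by (simp add: gamma_weight_def beta_weight_def k_def[symmetric] p p1)
           (simp add: power2_eq_square field_simps)
      finally show ?thesis by simp
    qed simp
  qed
  finally show ?thesis by (simp add: g01 f_def c_def)
qed

lemma nn_integral_gamma_pair:
  fixes F :: "real \<Rightarrow> real \<Rightarrow> ennreal"
  assumes s: "s > 0" and [measurable]: "(\<lambda>(x, y). F x y) \<in> borel_measurable (borel \<Otimes>\<^sub>M borel)"
  shows "(\<integral>\<^sup>+x. \<integral>\<^sup>+y. F x y \<partial>gamma_law s b \<partial>gamma_law s a)
       = (\<integral>\<^sup>+z. \<integral>\<^sup>+w. ennreal (gamma_weight s a (z * w) * gamma_weight s b (z * (1 - w)))
            * F (z * w) (z * (1 - w)) * ennreal z * indicator {0..} z * indicator {0..1} w \<partial>lborel \<partial>lborel)"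
proof -
  have "(\<integral>\<^sup>+x. \<integral>\<^sup>+y. F x y \<partial>gamma_law s b \<partial>gamma_law s a)
      = (\<integral>\<^sup>+x. \<integral>\<^sup>+y. ennreal (gamma_weight s b y) * F x y * indicator {0..} y \<partial>lborel \<partial>gamma_law s a)"
    by (intro nn_integral_cong nn_integral_gamma_law measurable_restrict_space1) measurable
  also have "\<dots> = (\<integral>\<^sup>+x. ennreal (gamma_weight s a x)
      * (\<integral>\<^sup>+y. ennreal (gamma_weight s b y) * F x y * indicator {0..} y \<partial>lborel) * indicator {0..} x \<partial>lborel)"
    by (intro nn_integral_gamma_law measurable_restrict_space1) measurable
  also have "\<dots> = (\<integral>\<^sup>+x. \<integral>\<^sup>+y. (ennreal (gamma_weight s a x * gamma_weight s b y) * F x y)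
      * indicator {0..} x * indicator {0..} y \<partial>lborel \<partial>lborel)"
    by (intro nn_integral_cong)
       (simp add: nn_integral_cmult[symmetric] nn_integral_multc[symmetric]
         ennreal_mult gamma_weight_nonneg s mult_ac)
  also have "\<dots> = (\<integral>\<^sup>+z. \<integral>\<^sup>+w. (ennreal (gamma_weight s a (z * w) * gamma_weight s b (z * (1 - w)))
      * F (z * w) (z * (1 - w))) * ennreal z * indicator {0..} z * indicator {0..1} w \<partial>lborel \<partial>lborel)"
    by (rule nn_integral_quadrant_sum_ratio) measurable
  finally show ?thesis .
qed

text \<open>Redistribution keeps \<open>x + y\<close>, so the left side depends on \<open>x\<close>
  and \<open>y\<close> only through \<open>z\<close>. Tonelli brings the integral over
  \<open>w\<close> innermost, the mixture identity replaces it by one over \<open>v\<close> for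
  fixed \<open>z\<close> and \<open>u\<close>, and Tonelli brings \<open>v\<close> to the
  outside.\<close>

lemma nn_integral_gamma_pair_redistribution_borel:
  fixes G :: "real \<Rightarrow> real \<Rightarrow> ennreal"
  assumes s: "s > 0" and a: "a > 0" and b: "b > 0"
    and [measurable]: "(\<lambda>(x, y). G x y) \<in> borel_measurable (borel \<Otimes>\<^sub>M borel)"
  shows "(\<integral>\<^sup>+x. \<integral>\<^sup>+y. \<integral>\<^sup>+u. G (u * (x + y)) ((1 - u) * (x + y))
            \<partial>beta_law (2 * s) (2 * s) \<partial>gamma_law s b \<partial>gamma_law s a)
       = (\<integral>\<^sup>+v. \<integral>\<^sup>+x. \<integral>\<^sup>+y. G x y \<partial>gamma_law s (a * v + b * (1 - v))
            \<partial>gamma_law s (a * v + b * (1 - v)) \<partial>beta_law (2 * s) (2 * s))"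
proof -
  define c where "c v = a * v + b * (1 - v)" for v
  have [measurable]: "c \<in> borel_measurable borel" unfolding c_def by measurable
  \<comment> \<open>\<open>B z\<close> is the mean of \<open>G\<close> after a total of
    \<open>z\<close> has been split by a beta variable.\<close>
  define B where "B z = (\<integral>\<^sup>+u. ennreal (beta_weight s u) * G (u * z) ((1 - u) * z) * indicator {0..1} u \<partial>lborel)"
    for z
  have [measurable]: "B \<in> borel_measurable borel" unfolding B_def by measurable
  define W where "W z w = ennreal (gamma_weight s a (z * w) * gamma_weight s b (z * (1 - w)))" for z w
  have [measurable]: "(\<lambda>(z, w). W z w) \<in> borel_measurable (borel \<Otimes>\<^sub>M borel)"
    unfolding W_def by measurable
  define W' where "W' v z u = ennreal (gamma_weight s (c v) (z * u) * gamma_weight s (c v) (z * (1 - u)))"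
    for v z u
  have "(\<integral>\<^sup>+x. \<integral>\<^sup>+y. \<integral>\<^sup>+u. G (u * (x + y)) ((1 - u) * (x + y))
          \<partial>beta_law (2 * s) (2 * s) \<partial>gamma_law s b \<partial>gamma_law s a)
      = (\<integral>\<^sup>+x. \<integral>\<^sup>+y. B (x + y) \<partial>gamma_law s b \<partial>gamma_law s a)"
    unfolding B_def
    by (intro nn_integral_cong nn_integral_beta_law measurable_restrict_space1) measurable
  also have "\<dots> = (\<integral>\<^sup>+z. \<integral>\<^sup>+w. W z w * B (z * w + z * (1 - w)) * ennreal z
                      * indicator {0..} z * indicator {0..1} w \<partial>lborel \<partial>lborel)"
    unfolding W_def by (rule nn_integral_gamma_pair[OF s]) measurable
  also have "\<dots> = (\<integral>\<^sup>+z. \<integral>\<^sup>+u. (\<integral>\<^sup>+w. W z w * ennreal (beta_weight s u) * indicator {0..1} w \<partial>lborel)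
                      * (G (u * z) ((1 - u) * z) * ennreal z * indicator {0..} z * indicator {0..1} u)
                      \<partial>lborel \<partial>lborel)"
  proof (rule nn_integral_cong)
    fix z :: real
    have "(\<integral>\<^sup>+w. W z w * B (z * w + z * (1 - w)) * ennreal z * indicator {0..} z * indicator {0..1} w \<partial>lborel)
        = (\<integral>\<^sup>+w. W z w * indicator {0..1} w * (ennreal z * indicator {0..} z * B z) \<partial>lborel)"
    proof (rule nn_integral_cong)
      fix w :: real
      have "z * w + z * (1 - w) = z" by (simp add: algebra_simps)
      then show "W z w * B (z * w + z * (1 - w)) * ennreal z * indicator {0..} z * indicator {0..1} w
          = W z w * indicator {0..1} w * (ennreal z * indicator {0..} z * B z)"
        by (simp only: mult_ac)
    qed
    also have "\<dots> = (\<integral>\<^sup>+w. W z w * indicator {0..1} w \<partial>lborel) * (ennreal z * indicator {0..} z) * B z"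
      by (subst nn_integral_multc) (measurable, simp add: mult_ac)
    also have "\<dots> = (\<integral>\<^sup>+u. (\<integral>\<^sup>+w. W z w * indicator {0..1} w \<partial>lborel) * (ennreal z * indicator {0..} z)
        * (ennreal (beta_weight s u) * G (u * z) ((1 - u) * z) * indicator {0..1} u) \<partial>lborel)"
      unfolding B_def by (rule nn_integral_cmult[symmetric]) measurable
    also have "\<dots> = (\<integral>\<^sup>+u. (\<integral>\<^sup>+w. W z w * indicator {0..1} w \<partial>lborel) * ennreal (beta_weight s u)
        * (G (u * z) ((1 - u) * z) * ennreal z * indicator {0..} z * indicator {0..1} u) \<partial>lborel)"
      by (simp add: mult_ac)
    also have "\<dots> = (\<integral>\<^sup>+u. (\<integral>\<^sup>+w. W z w * ennreal (beta_weight s u) * indicator {0..1} w \<partial>lborel)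
        * (G (u * z) ((1 - u) * z) * ennreal z * indicator {0..} z * indicator {0..1} u) \<partial>lborel)"
    proof (rule nn_integral_cong)
      fix u :: real
      have "(\<integral>\<^sup>+w. W z w * indicator {0..1} w \<partial>lborel) * ennreal (beta_weight s u)
          = (\<integral>\<^sup>+w. W z w * ennreal (beta_weight s u) * indicator {0..1} w \<partial>lborel)"
        by (subst nn_integral_multc[symmetric]) (measurable, simp add: mult_ac)
      then show "(\<integral>\<^sup>+w. W z w * indicator {0..1} w \<partial>lborel) * ennreal (beta_weight s u)
          * (G (u * z) ((1 - u) * z) * ennreal z * indicator {0..} z * indicator {0..1} u)
        = (\<integral>\<^sup>+w. W z w * ennreal (beta_weight s u) * indicator {0..1} w \<partial>lborel)
          * (G (u * z) ((1 - u) * z) * ennreal z * indicator {0..} z * indicator {0..1} u)"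
        by simp
    qed
    finally show "(\<integral>\<^sup>+w. W z w * B (z * w + z * (1 - w)) * ennreal z * indicator {0..} z * indicator {0..1} w \<partial>lborel)
      = (\<integral>\<^sup>+u. (\<integral>\<^sup>+w. W z w * ennreal (beta_weight s u) * indicator {0..1} w \<partial>lborel)
        * (G (u * z) ((1 - u) * z) * ennreal z * indicator {0..} z * indicator {0..1} u) \<partial>lborel)" .
  qed
  also have "\<dots> = (\<integral>\<^sup>+z. \<integral>\<^sup>+u. (\<integral>\<^sup>+v. ennreal (beta_weight s v) * W' v z u * indicator {0..1} v \<partial>lborel)
                      * (G (u * z) ((1 - u) * z) * ennreal z * indicator {0..} z * indicator {0..1} u)
                      \<partial>lborel \<partial>lborel)"
  proof (intro nn_integral_cong)
    fix z u :: real
    show "(\<integral>\<^sup>+w. W z w * ennreal (beta_weight s u) * indicator {0..1} w \<partial>lborel)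
          * (G (u * z) ((1 - u) * z) * ennreal z * indicator {0..} z * indicator {0..1} u)
        = (\<integral>\<^sup>+v. ennreal (beta_weight s v) * W' v z u * indicator {0..1} v \<partial>lborel)
          * (G (u * z) ((1 - u) * z) * ennreal z * indicator {0..} z * indicator {0..1} u)"
    \<comment> \<open>Outside this range the factor \<open>ennreal z\<close> or the indicator of
      \<open>u\<close> is 0 on both sides.\<close>
    proof (cases "z > 0 \<and> u \<in> {0..1}")
      case True
      then show ?thesis
        using gamma_pair_weight_mixture[OF s a b, of z u]
        by (simp add: W_def W'_def c_def ennreal_mult gamma_weight_nonneg beta_weight_nonneg s mult_ac)
    next
      case False
      then show ?thesis by (cases "z > 0") (auto simp: ennreal_neg)
    qed
  qed
  also have "\<dots> = (\<integral>\<^sup>+z. \<integral>\<^sup>+u. \<integral>\<^sup>+v. ennreal (beta_weight s v) * W' v z u * indicator {0..1} v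
                      * (G (u * z) ((1 - u) * z) * ennreal z * indicator {0..} z * indicator {0..1} u)
                      \<partial>lborel \<partial>lborel \<partial>lborel)"
    unfolding W'_def by (intro nn_integral_cong nn_integral_multc[symmetric]) measurable
  \<comment> \<open>The variable \<open>v\<close> passes the integral over \<open>u\<close> here and
    the one over \<open>z\<close> in the next step.\<close>
  also have "\<dots> = (\<integral>\<^sup>+z. \<integral>\<^sup>+v. \<integral>\<^sup>+u. ennreal (beta_weight s v) * W' v z u * indicator {0..1} v
                      * (G (u * z) ((1 - u) * z) * ennreal z * indicator {0..} z * indicator {0..1} u)
                      \<partial>lborel \<partial>lborel \<partial>lborel)"
    unfolding W'_def by (intro nn_integral_cong lborel_pair.Fubini') measurable
  also have "\<dots> = (\<integral>\<^sup>+v. \<integral>\<^sup>+z. \<integral>\<^sup>+u. ennreal (beta_weight s v) * W' v z u * indicator {0..1} v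
                      * (G (u * z) ((1 - u) * z) * ennreal z * indicator {0..} z * indicator {0..1} u)
                      \<partial>lborel \<partial>lborel \<partial>lborel)"
    unfolding W'_def by (intro lborel_pair.Fubini') measurable
  also have "\<dots> = (\<integral>\<^sup>+v. ennreal (beta_weight s v)
                      * (\<integral>\<^sup>+z. \<integral>\<^sup>+u. W' v z u * G (z * u) (z * (1 - u)) * ennreal z * indicator {0..} z
                           * indicator {0..1} u \<partial>lborel \<partial>lborel) * indicator {0..1} v \<partial>lborel)"
    unfolding W'_def by (intro nn_integral_cong)
       (simp add: nn_integral_cmult[symmetric] nn_integral_multc[symmetric] mult_ac)
  also have "\<dots> = (\<integral>\<^sup>+v. \<integral>\<^sup>+z. \<integral>\<^sup>+u. W' v z u * G (z * u) (z * (1 - u)) * ennreal z * indicator {0..} z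
                           * indicator {0..1} u \<partial>lborel \<partial>lborel \<partial>beta_law (2 * s) (2 * s))"
    unfolding W'_def by (intro nn_integral_beta_law[symmetric] measurable_restrict_space1) measurable
  also have "\<dots> = (\<integral>\<^sup>+v. \<integral>\<^sup>+x. \<integral>\<^sup>+y. G x y \<partial>gamma_law s (c v) \<partial>gamma_law s (c v) \<partial>beta_law (2 * s) (2 * s))"
    unfolding W'_def by (intro nn_integral_cong nn_integral_gamma_pair[OF s, symmetric]) measurable
  finally show ?thesis unfolding c_def .
qed

text \<open>Composing \<open>g\<close> with \<open>max 0\<close> in both arguments makes it Borel on
  the plane and leaves its values on the quadrant unchanged; the laws involved see no
  others.\<close>

lemma nn_integral_gamma_pair_redistribution:
  fixes g :: "real \<Rightarrow> real \<Rightarrow> ennreal"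
  assumes "s > 0" "a > 0" "b > 0"
    and g: "(\<lambda>(x, y). g x y) \<in> borel_measurable (restrict_space borel {0..} \<Otimes>\<^sub>M restrict_space borel {0..})"
  shows "(\<integral>\<^sup>+x. \<integral>\<^sup>+y. \<integral>\<^sup>+u. g (u * (x + y)) ((1 - u) * (x + y))
            \<partial>beta_law (2 * s) (2 * s) \<partial>gamma_law s b \<partial>gamma_law s a)
       = (\<integral>\<^sup>+v. \<integral>\<^sup>+x. \<integral>\<^sup>+y. g x y \<partial>gamma_law s (a * v + b * (1 - v))
            \<partial>gamma_law s (a * v + b * (1 - v)) \<partial>beta_law (2 * s) (2 * s))"
proof -
  have [measurable]: "(\<lambda>x. max 0 x) \<in> borel \<rightarrow>\<^sub>M restrict_space borel {0 :: real..}"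
    by (rule measurable_restrict_space2) auto
  have "(\<lambda>(x, y). (max 0 x, max 0 y))
      \<in> borel \<Otimes>\<^sub>M borel \<rightarrow>\<^sub>M restrict_space borel {0 :: real..} \<Otimes>\<^sub>M restrict_space borel {0 :: real..}"
    by measurable
  from measurable_compose[OF this g]
  have "(\<lambda>(x, y). g (max 0 x) (max 0 y)) \<in> borel_measurable (borel \<Otimes>\<^sub>M borel)"
    by (simp add: case_prod_beta')
  from nn_integral_gamma_pair_redistribution_borel[OF assms(1-3) this] show ?thesis
    by (simp add: space_gamma_law space_beta_law max_absorb2 cong: nn_integral_cong_simp)
qed

section \<open>The product of gamma laws as a kernel\<close>

abbreviation half_line :: "real measure" where
  "half_line \<equiv> restrict_space borel {0..}"

text \<open>Scale 0 is included so that the laws form a kernel on the closed half-line. There the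
  density is 0, through division by \<open>0 powr (2 * s) = 0\<close>.\<close>

lemma subprob_space_gamma_law:
  assumes s: "s > 0" and "\<theta> \<ge> 0"
  shows "subprob_space (gamma_law s \<theta>)"
proof (cases "\<theta> = 0")
  case True
  have "emeasure (gamma_law s 0) (space (gamma_law s 0)) = 0"
    using nn_integral_gamma_law[of "\<lambda>_. 1" s 0] s by (simp add: gamma_weight_def)
  then show ?thesis
    using True by (intro subprob_spaceI) (simp_all add: space_gamma_law)
next
  case False
  then show ?thesis
    using assms by (intro prob_space_imp_subprob_space prob_space_gamma_law) auto
qed

lemma emeasure_gamma_law:
  assumes "A \<in> sets half_line"
  shows "emeasure (gamma_law s \<theta>) A
           = (\<integral>\<^sup>+x. ennreal (gamma_weight s \<theta> x) * indicator A x * indicator {0..} x \<partial>lborel)"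
  using nn_integral_gamma_law[of "indicator A" s \<theta>] assms by (simp add: sets_gamma_law)

lemma measurable_gamma_law:
  assumes "s > 0"
  shows "gamma_law s \<in> half_line \<rightarrow>\<^sub>M subprob_algebra half_line"
proof (rule measurable_subprob_algebra)
  show "subprob_space (gamma_law s \<theta>)" if "\<theta> \<in> space half_line" for \<theta>
    using that assms by (intro subprob_space_gamma_law) (auto simp: space_restrict_space)
  show "sets (gamma_law s \<theta>) = sets half_line" for \<theta>
    by (rule sets_gamma_law)
  fix A assume A: "A \<in> sets half_line"
  then have [measurable]: "A \<in> sets borel"
    by (auto simp: sets_restrict_space_iff)
  have "(\<lambda>\<theta>. \<integral>\<^sup>+x. ennreal (gamma_weight s \<theta> x) * indicator A x * indicator {0..} x \<partial>lborel)
      \<in> borel_measurable borel"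
    by measurable
  then show "(\<lambda>\<theta>. emeasure (gamma_law s \<theta>) A) \<in> borel_measurable half_line"
    by (simp add: emeasure_gamma_law[OF A] measurable_restrict_space1)
qed

section \<open>Product laws on the closed orthant\<close>

lemma space_orthant: "space orthant = {\<zeta>. \<forall>i. 0 \<le> \<zeta> i}"
  by (auto simp: orthant_def space_PiM space_restrict_space)

lemma measurable_into_orthant:
  assumes "\<And>k. (\<lambda>\<omega>. f \<omega> k) \<in> N \<rightarrow>\<^sub>M half_line"
  shows "f \<in> N \<rightarrow>\<^sub>M orthant"
  unfolding orthant_def
  by (rule measurable_PiM_single'[where f = "\<lambda>k \<omega>. f \<omega> k"])
     (use assms measurable_space[OF assms] in auto)

lemma measurable_orthant_component: "(\<lambda>\<zeta>. \<zeta> k) \<in> orthant \<rightarrow>\<^sub>M half_line"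
  unfolding orthant_def by measurable

lemma sets_gamma_product: "sets (gamma_product s \<theta>) = sets orthant"
  unfolding gamma_product_def orthant_def by (intro sets_PiM_cong refl sets_gamma_law)

lemma space_gamma_product: "space (gamma_product s \<theta>) = space orthant"
  by (rule sets_eq_imp_space_eq[OF sets_gamma_product])

lemma prob_space_gamma_product:
  "s > 0 \<Longrightarrow> (\<And>i. \<theta> i > 0) \<Longrightarrow> prob_space (gamma_product s \<theta>)"
  unfolding gamma_product_def by (intro prob_space_PiM prob_space_gamma_law)

text \<open>Boundary points allow null factors, so the product formula is taken from sigma-finite
  measures instead of probability spaces.\<close>

lemma emeasure_gamma_product:
  assumes s: "s > 0" and \<theta>: "\<theta> \<in> space orthant" and A: "\<And>i. A i \<in> sets half_line"
  shows "emeasure (gamma_product s \<theta>) (Pi\<^sub>E UNIV A) = (\<Prod>i\<in>UNIV. emeasure (gamma_law s (\<theta> i)) (A i))"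
proof -
  have "subprob_space (gamma_law s (\<theta> i))" for i
    using s \<theta> by (intro subprob_space_gamma_law) (auto simp: space_orthant)
  then interpret product_sigma_finite "\<lambda>i. gamma_law s (\<theta> i)"
    by (intro product_sigma_finite.intro finite_measure.sigma_finite_measure)
       (simp add: subprob_space_def finite_measure_def)
  show ?thesis
    unfolding gamma_product_def by (rule emeasure_PiM) (use A in \<open>simp_all add: sets_gamma_law\<close>)
qed

text \<open>Measurability of a kernel may be tested on an intersection-stable generator together
  with the whole space. On boxes the mass is a finite product of masses, each measurable in one
  coordinate of \<theta>.\<close>

lemma measurable_gamma_product:
  assumes s: "s > 0"
  shows "gamma_product s \<in> orthant \<rightarrow>\<^sub>M subprob_algebra (orthant :: ('v::finite \<Rightarrow> real) measure)"
proof (rule measurable_subprob_algebra_generated)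
  let ?G = "prod_algebra UNIV (\<lambda>_ :: 'v. half_line)"
  show "sets orthant = sigma_sets (\<Pi>\<^sub>E i\<in>UNIV. space half_line) ?G"
    unfolding orthant_def by (rule sets_PiM)
  show "Int_stable ?G" by (rule Int_stable_prod_algebra)
  show "?G \<subseteq> Pow (\<Pi>\<^sub>E i\<in>UNIV. space half_line)" by (rule prod_algebra_sets_into_space)
  have rect: "(\<lambda>\<theta>. emeasure (gamma_product s \<theta>) (Pi\<^sub>E UNIV A)) \<in> borel_measurable orthant"
    if A: "\<And>i :: 'v. A i \<in> sets half_line" for A
  proof -
    have "(\<lambda>\<theta>. emeasure (gamma_law s (\<theta> i)) (A i)) \<in> borel_measurable orthant" for i :: 'v
      by (rule measurable_emeasure_kernel[OF measurable_compose[OF measurable_orthant_component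
            measurable_gamma_law[OF s]] A])
    then have "(\<lambda>\<theta>. \<Prod>i\<in>UNIV. emeasure (gamma_law s (\<theta> i)) (A i)) \<in> borel_measurable orthant"
      by measurable
    then show ?thesis
      by (subst measurable_cong[OF emeasure_gamma_product[OF s _ A]])
  qed
  show "(\<lambda>\<theta>. emeasure (gamma_product s \<theta>) A) \<in> borel_measurable orthant" if "A \<in> ?G" for A
    using that rect by (auto simp: prod_algebra_eq_finite)
  show "(\<lambda>\<theta> :: 'v \<Rightarrow> real. emeasure (gamma_product s \<theta>) (\<Pi>\<^sub>E i\<in>UNIV. space half_line)) \<in> borel_measurable orthant"
    by (rule rect) (rule sets.top)
  show "subprob_space (gamma_product s \<theta>)" if \<theta>: "\<theta> \<in> space orthant" for \<theta> :: "'v \<Rightarrow> real"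
  proof
    have "emeasure (gamma_product s \<theta>) (\<Pi>\<^sub>E i\<in>UNIV. space half_line)
        = (\<Prod>i\<in>UNIV. emeasure (gamma_law s (\<theta> i)) (space half_line))"
      by (rule emeasure_gamma_product[OF s \<theta>]) (rule sets.top)
    also have "\<dots> \<le> (\<Prod>i\<in>(UNIV :: 'v set). 1)"
      using subprob_space.subprob_emeasure_le_1[OF subprob_space_gamma_law[OF s]] \<theta>
      by (intro prod_mono_ennreal) (simp_all add: space_orthant)
    finally show "emeasure (gamma_product s \<theta>) (space (gamma_product s \<theta>)) \<le> 1"
      by (simp add: space_gamma_product orthant_def space_PiM)
    show "space (gamma_product s \<theta>) \<noteq> {}"
      using \<theta> by (auto simp: space_gamma_product)
  qed
  show "sets (gamma_product s \<theta>) = sets orthant" for \<theta> :: "'v \<Rightarrow> real"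
    by (rule sets_gamma_product)
qed

section \<open>The generators on bounded measurable functions\<close>

lemma measurable_snd_beta_law: "snd \<in> N \<Otimes>\<^sub>M beta_law a b \<rightarrow>\<^sub>M (borel :: real measure)"
proof (rule measurable_compose[OF measurable_snd])
  show "(\<lambda>u. u) \<in> beta_law a b \<rightarrow>\<^sub>M borel"
    by (simp add: measurable_cong_sets[OF sets_beta_law refl] measurable_restrict_space1)
qed

lemma measurable_kmp_update:
  fixes i j :: "'v::finite"
  shows "(\<lambda>(\<zeta>, u). \<zeta>(i := u * (\<zeta> i + \<zeta> j), j := (1 - u) * (\<zeta> i + \<zeta> j)))
           \<in> orthant \<Otimes>\<^sub>M beta_law a b \<rightarrow>\<^sub>M orthant"
proof (rule measurable_into_orthant)
  fix k
  have half: "(\<lambda>z. fst z l) \<in> orthant \<Otimes>\<^sub>M beta_law a b \<rightarrow>\<^sub>M half_line" for l :: 'v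
    using measurable_compose[OF measurable_fst measurable_orthant_component] .
  note [measurable] = measurable_snd_beta_law
  have [measurable]: "(\<lambda>z. fst z l) \<in> orthant \<Otimes>\<^sub>M beta_law a b \<rightarrow>\<^sub>M borel" for l :: 'v
    using half[of l] by (simp add: measurable_restrict_space2_iff)
  have "(\<lambda>z. snd z * (fst z i + fst z j)) \<in> orthant \<Otimes>\<^sub>M beta_law a b \<rightarrow>\<^sub>M half_line"
    "(\<lambda>z. (1 - snd z) * (fst z i + fst z j)) \<in> orthant \<Otimes>\<^sub>M beta_law a b \<rightarrow>\<^sub>M half_line"
    by (auto intro!: measurable_restrict_space2
        simp: space_pair_measure space_orthant space_beta_law)
  with half show "(\<lambda>z. (case z of (\<zeta>, u) \<Rightarrow> \<zeta>(i := u * (\<zeta> i + \<zeta> j), j := (1 - u) * (\<zeta> i + \<zeta> j))) k)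
      \<in> orthant \<Otimes>\<^sub>M beta_law a b \<rightarrow>\<^sub>M half_line"
    by (cases "k = j"; cases "k = i") (simp_all add: case_prod_beta' fun_upd_def)
qed

lemma measurable_hidden_update:
  fixes i j :: "'v::finite"
  shows "(\<lambda>(\<theta>, u). \<theta>(i := \<theta> i * u + \<theta> j * (1 - u), j := \<theta> i * u + \<theta> j * (1 - u)))
           \<in> orthant \<Otimes>\<^sub>M beta_law a b \<rightarrow>\<^sub>M orthant"
proof (rule measurable_into_orthant)
  fix k
  have half: "(\<lambda>z. fst z l) \<in> orthant \<Otimes>\<^sub>M beta_law a b \<rightarrow>\<^sub>M half_line" for l :: 'v
    using measurable_compose[OF measurable_fst measurable_orthant_component] .
  note [measurable] = measurable_snd_beta_law
  have [measurable]: "(\<lambda>z. fst z l) \<in> orthant \<Otimes>\<^sub>M beta_law a b \<rightarrow>\<^sub>M borel" for l :: 'v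
    using half[of l] by (simp add: measurable_restrict_space2_iff)
  have "(\<lambda>z. fst z i * snd z + fst z j * (1 - snd z)) \<in> orthant \<Otimes>\<^sub>M beta_law a b \<rightarrow>\<^sub>M half_line"
    by (auto intro!: measurable_restrict_space2 simp: space_pair_measure space_orthant space_beta_law)
  with half show "(\<lambda>z. (case z of (\<theta>, u) \<Rightarrow>
        \<theta>(i := \<theta> i * u + \<theta> j * (1 - u), j := \<theta> i * u + \<theta> j * (1 - u))) k)
      \<in> orthant \<Otimes>\<^sub>M beta_law a b \<rightarrow>\<^sub>M half_line"
    by (cases "k = j"; cases "k = i") (simp_all add: case_prod_beta' fun_upd_def)
qed

section \<open>Jump operators and their norms\<close>

lemma bounded_measurable_compose:
  "\<lbrakk>bounded_measurable E K f; \<phi> \<in> M \<rightarrow>\<^sub>M E\<rbrakk> \<Longrightarrow> bounded_measurable M K (\<lambda>x. f (\<phi> x))"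
  by (auto simp: bounded_measurable_def dest: measurable_space)

lemma bounded_measurable_section:
  assumes f: "bounded_measurable E K f" and \<Phi>: "(\<lambda>(x, u). \<Phi> u x) \<in> E \<Otimes>\<^sub>M N \<rightarrow>\<^sub>M E" and x: "x \<in> space E"
  shows "bounded_measurable N K (\<lambda>u. f (\<Phi> u x))"
  by (rule bounded_measurable_compose[OF f])
     (use measurable_compose[OF measurable_Pair1'[OF x] \<Phi>] in simp)

lemma bounded_measurable_integral_pair:
  assumes N: "prob_space N" and f: "bounded_measurable E K f"
    and \<Phi>: "(\<lambda>(x, u). \<Phi> u x) \<in> E \<Otimes>\<^sub>M N \<rightarrow>\<^sub>M E"
  shows "bounded_measurable E K (\<lambda>x. \<integral>u. f (\<Phi> u x) \<partial>N)"
  unfolding bounded_measurable_def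
proof (intro conjI ballI)
  interpret prob_space N by fact
  have "bounded_measurable (E \<Otimes>\<^sub>M N) K (\<lambda>(x, u). f (\<Phi> u x))"
    using bounded_measurable_compose[OF f \<Phi>] by (simp add: case_prod_beta')
  then show "(\<lambda>x. \<integral>u. f (\<Phi> u x) \<partial>N) \<in> borel_measurable E"
    by (intro borel_measurable_lebesgue_integral) (simp add: bounded_measurable_def)
  fix x assume "x \<in> space E"
  from bounded_measurable_section[OF f \<Phi> this] show "\<bar>\<integral>u. f (\<Phi> u x) \<partial>N\<bar> \<le> K"
    by (intro bounded_measurable_integral(2)[OF prob_space_imp_subprob_space[OF N] refl])
qed

lemma pair_generator_eq:
  assumes N: "prob_space N" and f: "bounded_measurable E K f"
    and \<Phi>: "(\<lambda>(x, u). \<Phi> u x) \<in> E \<Otimes>\<^sub>M N \<rightarrow>\<^sub>M E" and x: "x \<in> space E"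
  shows "(\<integral>u. f (\<Phi> u x) - f x \<partial>N) = (\<integral>u. f (\<Phi> u x) \<partial>N) - f x"
proof -
  interpret prob_space N by fact
  have "integrable N (\<lambda>u. f (\<Phi> u x))"
    by (rule bounded_measurable_integral(1)[OF prob_space_imp_subprob_space[OF N] refl
          bounded_measurable_section[OF f \<Phi> x]])
  then show ?thesis by (simp add: prob_space)
qed

text \<open>Both pair generators are of this shape, with \<Phi> the jump and \<open>N\<close> the
  beta law. One \<open>K\<close> comes from the mean after the jump, the other from
  \<open>f x\<close>.\<close>

lemma bounded_measurable_pair_generator:
  assumes N: "prob_space N" and f: "bounded_measurable E K f"
    and \<Phi>: "(\<lambda>(x, u). \<Phi> u x) \<in> E \<Otimes>\<^sub>M N \<rightarrow>\<^sub>M E"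
  shows "bounded_measurable E (2 * K) (\<lambda>x. \<integral>u. f (\<Phi> u x) - f x \<partial>N)"
proof -
  have "bounded_measurable E (2 * K) (\<lambda>x. (\<integral>u. f (\<Phi> u x) \<partial>N) - f x)"
    using bounded_measurable_integral_pair[OF assms] f
    by (fastforce simp: bounded_measurable_def)
  then show ?thesis
    by (simp add: bounded_measurable_def pair_generator_eq[OF assms]
        cong: measurable_cong)
qed

text \<open>The sum is twice the total rate; it becomes the constant \<open>C\<close> of both
  semigroups.\<close>

lemma bounded_measurable_pair_sum:
  fixes p :: "'v::finite \<Rightarrow> 'v \<Rightarrow> real"
  assumes "\<And>i j. p i j \<ge> 0" and g: "\<And>i j. bounded_measurable E (2 * K) (g i j)"
  shows "bounded_measurable E ((\<Sum>i\<in>UNIV. \<Sum>j\<in>UNIV - {i}. 2 * p i j) * K)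
           (\<lambda>x. \<Sum>i\<in>UNIV. \<Sum>j\<in>UNIV - {i}. p i j * g i j x)"
  unfolding bounded_measurable_def
proof (intro conjI ballI)
  have [measurable]: "g i j \<in> borel_measurable E" for i j
    using g by (simp add: bounded_measurable_def)
  show "(\<lambda>x. \<Sum>i\<in>UNIV. \<Sum>j\<in>UNIV - {i}. p i j * g i j x) \<in> borel_measurable E"
    by measurable
  fix x assume "x \<in> space E"
  then have "\<bar>p i j * g i j x\<bar> \<le> 2 * p i j * K" for i j
    using g[of i j] assms(1)[of i j] mult_left_mono[of "\<bar>g i j x\<bar>" "2 * K" "p i j"]
    by (simp add: bounded_measurable_def abs_mult)
  then have "\<bar>\<Sum>i\<in>UNIV. \<Sum>j\<in>UNIV - {i}. p i j * g i j x\<bar>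
      \<le> (\<Sum>i\<in>UNIV. \<Sum>j\<in>UNIV - {i}. 2 * p i j * K)"
    by (intro order_trans[OF sum_abs] sum_mono)
  then show "\<bar>\<Sum>i\<in>UNIV. \<Sum>j\<in>UNIV - {i}. p i j * g i j x\<bar>
      \<le> (\<Sum>i\<in>UNIV. \<Sum>j\<in>UNIV - {i}. 2 * p i j) * K"
    by (simp add: sum_distrib_right)
qed

lemma bounded_measurable_kmp_pair_generator:
  "s > 0 \<Longrightarrow> bounded_measurable orthant K f
    \<Longrightarrow> bounded_measurable orthant (2 * K) (kmp_pair_generator s i j f)"
  unfolding kmp_pair_generator_def[abs_def]
  by (rule bounded_measurable_pair_generator[OF prob_space_beta_law _ measurable_kmp_update])

lemma bounded_measurable_hidden_pair_generator:
  "s > 0 \<Longrightarrow> bounded_measurable orthant K f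
    \<Longrightarrow> bounded_measurable orthant (2 * K) (hidden_pair_generator s i j f)"
  unfolding hidden_pair_generator_def[abs_def]
  by (rule bounded_measurable_pair_generator[OF prob_space_beta_law _ measurable_hidden_update])

lemma bounded_measurable_kmp_generator:
  assumes "s > 0" "\<And>i j. p i j \<ge> 0" "bounded_measurable orthant K f"
  shows "bounded_measurable orthant ((\<Sum>i\<in>UNIV. \<Sum>j\<in>UNIV - {i}. 2 * p i j) * K) (kmp_generator s p f)"
  unfolding kmp_generator_def[abs_def]
  by (intro bounded_measurable_pair_sum bounded_measurable_kmp_pair_generator assms)

lemma bounded_measurable_hidden_generator:
  assumes "s > 0" "\<And>i j. p i j \<ge> 0" "bounded_measurable orthant K f"
  shows "bounded_measurable orthant ((\<Sum>i\<in>UNIV. \<Sum>j\<in>UNIV - {i}. 2 * p i j) * K) (hidden_generator s p f)"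
  unfolding hidden_generator_def[abs_def]
  by (intro bounded_measurable_pair_sum bounded_measurable_hidden_pair_generator assms)

text \<open>The averaged function is the test function to which \<open>Q\<close> is applied, hence
  the claim on the closed orthant and the use of the subprobability kernel.\<close>

lemma bounded_measurable_gamma_product:
  fixes f :: "('v::finite \<Rightarrow> real) \<Rightarrow> real"
  assumes s: "s > 0" and f: "bounded_measurable orthant K f"
  shows "bounded_measurable orthant K (\<lambda>\<theta>. \<integral>\<zeta>. f \<zeta> \<partial>gamma_product s \<theta>)"
  unfolding bounded_measurable_def
proof (intro conjI ballI)
  have [measurable]: "f \<in> borel_measurable orthant"
    using f by (simp add: bounded_measurable_def)
  note [measurable] = measurable_gamma_product[OF s]
  show "(\<lambda>\<theta>. \<integral>\<zeta>. f \<zeta> \<partial>gamma_product s \<theta>) \<in> borel_measurable orthant"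
    by measurable
  fix \<theta> :: "'v \<Rightarrow> real" assume "\<theta> \<in> space orthant"
  then have "subprob_space (gamma_product s \<theta>)"
    using measurable_space[OF measurable_gamma_product[OF s], of \<theta>]
    by (simp add: space_subprob_algebra)
  then show "\<bar>\<integral>\<zeta>. f \<zeta> \<partial>gamma_product s \<theta>\<bar> \<le> K"
    using bounded_measurable_integral(2) sets_gamma_product f by blast
qed

lemma nn_integral_gamma_product_pair:
  fixes h :: "('v::finite \<Rightarrow> real) \<Rightarrow> ennreal"
  assumes s: "s > 0" and \<theta>: "\<And>i. \<theta> i > 0" and ij: "i \<noteq> j"
    and h[measurable]: "h \<in> borel_measurable orthant"
  shows "(\<integral>\<^sup>+\<zeta>. h \<zeta> \<partial>gamma_product s \<theta>)
       = (\<integral>\<^sup>+x. \<integral>\<^sup>+y. \<integral>\<^sup>+z. h (x(i := y, j := z)) \<partial>gamma_law s (\<theta> j) \<partial>gamma_law s (\<theta> i)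
            \<partial>(\<Pi>\<^sub>M k\<in>UNIV - {i, j}. gamma_law s (\<theta> k)))"
proof -
  interpret prob_space "gamma_law s (\<theta> k)" for k
    by (rule prob_space_gamma_law[OF s \<theta>])
  interpret product_sigma_finite "\<lambda>k. gamma_law s (\<theta> k)"
    by unfold_locales
  let ?M = "\<lambda>k. gamma_law s (\<theta> k)"
  \<comment> \<open>Coordinates \<open>i\<close> and \<open>j\<close> are inserted last, so that
    they become the innermost integrals.\<close>
  have U: "UNIV = insert j (insert i (UNIV - {i, j}))" by auto
  have [measurable]: "h \<in> borel_measurable (Pi\<^sub>M (insert j (insert i (UNIV - {i, j}))) ?M)"
    using h unfolding U[symmetric]
    by (simp add: measurable_cong_sets[OF sets_gamma_product[unfolded gamma_product_def, of s \<theta>] refl])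
  have "(\<integral>\<^sup>+\<zeta>. h \<zeta> \<partial>gamma_product s \<theta>) = (\<integral>\<^sup>+\<zeta>. h \<zeta> \<partial>Pi\<^sub>M (insert j (insert i (UNIV - {i, j}))) ?M)"
    unfolding gamma_product_def U[symmetric] ..
  also have "\<dots> = (\<integral>\<^sup>+x. \<integral>\<^sup>+z. h (x(j := z)) \<partial>?M j \<partial>Pi\<^sub>M (insert i (UNIV - {i, j})) ?M)"
    using ij by (intro product_nn_integral_insert) auto
  also have "\<dots> = (\<integral>\<^sup>+x. \<integral>\<^sup>+y. \<integral>\<^sup>+z. h (x(i := y, j := z)) \<partial>?M j \<partial>?M i \<partial>Pi\<^sub>M (UNIV - {i, j}) ?M)"
    by (intro product_nn_integral_insert) (simp, simp, measurable)
  finally show ?thesis .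
qed

section \<open>Intertwining of the generators\<close>

text \<open>Coordinates \<open>i\<close> and \<open>j\<close> of \<open>X\<close> are overwritten.
  Points of the product over \<open>UNIV - {i, j}\<close> are \<open>undefined\<close> there, which
  is why only the other coordinates are constrained.\<close>

lemma measurable_update_pair_orthant:
  fixes X :: "'a \<Rightarrow> 'v::finite \<Rightarrow> real"
  assumes "\<And>k. k \<in> UNIV - {i, j} \<Longrightarrow> (\<lambda>\<omega>. X \<omega> k) \<in> N \<rightarrow>\<^sub>M half_line"
    and "Y \<in> N \<rightarrow>\<^sub>M half_line" "Z \<in> N \<rightarrow>\<^sub>M half_line"
  shows "(\<lambda>\<omega>. (X \<omega>)(i := Y \<omega>, j := Z \<omega>)) \<in> N \<rightarrow>\<^sub>M orthant"
proof (rule measurable_into_orthant)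
  fix k
  show "(\<lambda>\<omega>. ((X \<omega>)(i := Y \<omega>, j := Z \<omega>)) k) \<in> N \<rightarrow>\<^sub>M half_line"
    using assms by (cases "k = j"; cases "k = i") simp_all
qed

lemma convex_combination_pos:
  "(a :: real) > 0 \<Longrightarrow> b > 0 \<Longrightarrow> v \<in> {0..1} \<Longrightarrow> a * v + b * (1 - v) > 0"
  by (cases "v = 0") (auto intro!: add_pos_nonneg)

lemma nn_integral_kmp_update_gamma_product:
  fixes h :: "('v::finite \<Rightarrow> real) \<Rightarrow> ennreal"
  assumes s: "s > 0" and \<theta>: "\<And>k. \<theta> k > 0" and ij: "i \<noteq> j"
    and h[measurable]: "h \<in> borel_measurable orthant"
  shows "(\<integral>\<^sup>+\<zeta>. \<integral>\<^sup>+u. h (\<zeta>(i := u * (\<zeta> i + \<zeta> j), j := (1 - u) * (\<zeta> i + \<zeta> j)))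
            \<partial>beta_law (2 * s) (2 * s) \<partial>gamma_product s \<theta>)
       = (\<integral>\<^sup>+v. \<integral>\<^sup>+\<zeta>. h \<zeta> \<partial>gamma_product s (\<theta>(i := \<theta> i * v + \<theta> j * (1 - v), j := \<theta> i * v + \<theta> j * (1 - v)))
            \<partial>beta_law (2 * s) (2 * s))"
proof -
  let ?\<beta> = "beta_law (2 * s) (2 * s)"
  let ?R = "\<Pi>\<^sub>M k\<in>UNIV - {i, j}. gamma_law s (\<theta> k)"
  define c where "c v = \<theta> i * v + \<theta> j * (1 - v)" for v
  interpret \<beta>: prob_space ?\<beta> by (rule prob_space_beta_law[OF s])
  interpret R: prob_space ?R by (intro prob_space_PiM prob_space_gamma_law[OF s \<theta>])
  interpret pair_sigma_finite ?\<beta> ?R by unfold_locales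
  have c_pos: "c v > 0" if "v \<in> {0..1}" for v
    unfolding c_def by (rule convex_combination_pos) (use that \<theta> in auto)
  have comp: "(\<lambda>x. x k) \<in> ?R \<rightarrow>\<^sub>M half_line" if "k \<in> UNIV - {i, j}" for k
    using measurable_component_singleton[of k "UNIV - {i, j}" "\<lambda>k. gamma_law s (\<theta> k)"] that
    by (simp add: measurable_cong_sets[OF refl sets_gamma_law])
  have "(\<lambda>v. c v) \<in> ?\<beta> \<rightarrow>\<^sub>M half_line"
    unfolding measurable_cong_sets[OF sets_beta_law refl]
    by (intro measurable_restrict_space2 measurable_restrict_space1)
       (use c_pos in \<open>auto simp: c_def space_restrict_space less_imp_le\<close>)
  then have \<gamma>: "(\<lambda>v. gamma_law s (c v)) \<in> ?\<beta> \<rightarrow>\<^sub>M subprob_algebra half_line"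
    by (rule measurable_compose[OF _ measurable_gamma_law[OF s]])
  have "(\<lambda>\<zeta>. \<integral>\<^sup>+u. h (\<zeta>(i := u * (\<zeta> i + \<zeta> j), j := (1 - u) * (\<zeta> i + \<zeta> j))) \<partial>?\<beta>) \<in> borel_measurable orthant"
    using measurable_compose[OF measurable_kmp_update h, of i j "2 * s" "2 * s"]
    by (intro \<beta>.borel_measurable_nn_integral) (simp add: case_prod_beta')
  then have "(\<integral>\<^sup>+\<zeta>. \<integral>\<^sup>+u. h (\<zeta>(i := u * (\<zeta> i + \<zeta> j), j := (1 - u) * (\<zeta> i + \<zeta> j))) \<partial>?\<beta> \<partial>gamma_product s \<theta>)
      = (\<integral>\<^sup>+x. \<integral>\<^sup>+y. \<integral>\<^sup>+z. \<integral>\<^sup>+u. h (x(i := u * (y + z), j := (1 - u) * (y + z)))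
           \<partial>?\<beta> \<partial>gamma_law s (\<theta> j) \<partial>gamma_law s (\<theta> i) \<partial>?R)"
    using ij by (simp add: nn_integral_gamma_product_pair[OF s \<theta> ij] fun_upd_twist)
  also have "\<dots> = (\<integral>\<^sup>+x. \<integral>\<^sup>+v. \<integral>\<^sup>+y. \<integral>\<^sup>+z. h (x(i := y, j := z)) \<partial>gamma_law s (c v) \<partial>gamma_law s (c v) \<partial>?\<beta> \<partial>?R)"
  proof (rule nn_integral_cong)
    fix x assume x: "x \<in> space ?R"
    have "(\<lambda>w. x(i := fst w, j := snd w)) \<in> half_line \<Otimes>\<^sub>M half_line \<rightarrow>\<^sub>M orthant"
    proof (rule measurable_update_pair_orthant)
      fix k assume "k \<in> UNIV - {i, j}"
      then show "(\<lambda>w. x k) \<in> half_line \<Otimes>\<^sub>M half_line \<rightarrow>\<^sub>M half_line"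
        using measurable_space[OF comp x] by (intro measurable_const)
    qed auto
    from measurable_compose[OF this h]
    show "(\<integral>\<^sup>+y. \<integral>\<^sup>+z. \<integral>\<^sup>+u. h (x(i := u * (y + z), j := (1 - u) * (y + z)))
             \<partial>?\<beta> \<partial>gamma_law s (\<theta> j) \<partial>gamma_law s (\<theta> i))
        = (\<integral>\<^sup>+v. \<integral>\<^sup>+y. \<integral>\<^sup>+z. h (x(i := y, j := z)) \<partial>gamma_law s (c v) \<partial>gamma_law s (c v) \<partial>?\<beta>)"
      unfolding c_def
      by (intro nn_integral_gamma_pair_redistribution[OF s \<theta> \<theta>]) (simp add: case_prod_beta' fun_upd_def)
  qed
  also have "\<dots> = (\<integral>\<^sup>+v. \<integral>\<^sup>+x. \<integral>\<^sup>+y. \<integral>\<^sup>+z. h (x(i := y, j := z)) \<partial>gamma_law s (c v) \<partial>gamma_law s (c v) \<partial>?R \<partial>?\<beta>)"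
  proof (rule Fubini')
    \<comment> \<open>Tonelli asks for joint measurability in \<open>v\<close> and \<open>x\<close>
      of an iterated integral whose laws depend on \<open>v\<close>. It is obtained from the
      integrand by one kernel integral at a time, innermost first.\<close>
    have "(\<lambda>\<omega>. (snd (fst (fst \<omega>)))(i := snd (fst \<omega>), j := snd \<omega>))
        \<in> ((?\<beta> \<Otimes>\<^sub>M ?R) \<Otimes>\<^sub>M half_line) \<Otimes>\<^sub>M half_line \<rightarrow>\<^sub>M orthant"
      by (rule measurable_update_pair_orthant)
         (use comp in \<open>auto intro: measurable_compose[OF _ comp]\<close>)
    from measurable_compose[OF this h]
    have "(\<lambda>(\<omega>, z). h ((snd (fst \<omega>))(i := snd \<omega>, j := z)))
        \<in> borel_measurable (((?\<beta> \<Otimes>\<^sub>M ?R) \<Otimes>\<^sub>M half_line) \<Otimes>\<^sub>M half_line)"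
      by (simp add: case_prod_beta')
    moreover have "(\<lambda>\<omega>. gamma_law s (c (fst (fst \<omega>))))
        \<in> (?\<beta> \<Otimes>\<^sub>M ?R) \<Otimes>\<^sub>M half_line \<rightarrow>\<^sub>M subprob_algebra half_line"
      by (intro measurable_compose[OF _ \<gamma>]) measurable
    ultimately have "(\<lambda>\<omega>. \<integral>\<^sup>+z. h ((snd (fst \<omega>))(i := snd \<omega>, j := z)) \<partial>gamma_law s (c (fst (fst \<omega>))))
        \<in> borel_measurable ((?\<beta> \<Otimes>\<^sub>M ?R) \<Otimes>\<^sub>M half_line)"
      by (rule nn_integral_measurable_subprob_algebra2)
    then have "(\<lambda>(\<omega>, y). \<integral>\<^sup>+z. h ((snd \<omega>)(i := y, j := z)) \<partial>gamma_law s (c (fst \<omega>)))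
        \<in> borel_measurable ((?\<beta> \<Otimes>\<^sub>M ?R) \<Otimes>\<^sub>M half_line)"
      by (simp add: case_prod_beta')
    moreover have "(\<lambda>\<omega>. gamma_law s (c (fst \<omega>))) \<in> ?\<beta> \<Otimes>\<^sub>M ?R \<rightarrow>\<^sub>M subprob_algebra half_line"
      by (intro measurable_compose[OF _ \<gamma>]) measurable
    ultimately have "(\<lambda>\<omega>. \<integral>\<^sup>+y. \<integral>\<^sup>+z. h ((snd \<omega>)(i := y, j := z)) \<partial>gamma_law s (c (fst \<omega>)) \<partial>gamma_law s (c (fst \<omega>)))
        \<in> borel_measurable (?\<beta> \<Otimes>\<^sub>M ?R)"
      by (rule nn_integral_measurable_subprob_algebra2)
    then show "(\<lambda>(v, x). \<integral>\<^sup>+y. \<integral>\<^sup>+z. h (x(i := y, j := z)) \<partial>gamma_law s (c v) \<partial>gamma_law s (c v))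
        \<in> borel_measurable (?\<beta> \<Otimes>\<^sub>M ?R)"
      by (simp add: case_prod_beta')
  qed
  also have "\<dots> = (\<integral>\<^sup>+v. \<integral>\<^sup>+\<zeta>. h \<zeta> \<partial>gamma_product s (\<theta>(i := c v, j := c v)) \<partial>?\<beta>)"
  proof (rule nn_integral_cong)
    fix v assume "v \<in> space ?\<beta>"
    then have pos: "\<And>k. (\<theta>(i := c v, j := c v)) k > 0"
      using c_pos \<theta> by (simp add: space_beta_law)
    have R: "(\<Pi>\<^sub>M k\<in>UNIV - {i, j}. gamma_law s ((\<theta>(i := c v, j := c v)) k)) = ?R"
      by (intro PiM_cong) auto
    show "(\<integral>\<^sup>+x. \<integral>\<^sup>+y. \<integral>\<^sup>+z. h (x(i := y, j := z)) \<partial>gamma_law s (c v) \<partial>gamma_law s (c v) \<partial>?R)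
        = (\<integral>\<^sup>+\<zeta>. h \<zeta> \<partial>gamma_product s (\<theta>(i := c v, j := c v)))"
      using ij by (subst nn_integral_gamma_product_pair[OF s pos ij h], subst R) simp
  qed
  finally show ?thesis unfolding c_def .
qed

text \<open>Adding \<open>K\<close> makes \<open>f\<close> nonnegative, which carries the Tonelli
  identities over to Bochner integrals of bounded functions. The mass has to be exactly 1 for the
  added constant to be the same on both sides.\<close>

lemma nn_integral_bounded_measurable:
  assumes N: "prob_space N" and sets: "sets N = sets E" and f: "bounded_measurable E K f"
  shows "(\<integral>\<^sup>+x. ennreal (f x + K) \<partial>N) = ennreal ((\<integral>x. f x \<partial>N) + K)"
proof -
  interpret prob_space N by fact
  note int = bounded_measurable_integral(1)[OF prob_space_imp_subprob_space[OF N] sets f]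
  have "0 \<le> f x + K" if "x \<in> space N" for x
    using f that sets_eq_imp_space_eq[OF sets] by (force simp: bounded_measurable_def abs_le_iff)
  then have "(\<integral>\<^sup>+x. ennreal (f x + K) \<partial>N) = ennreal (\<integral>x. f x + K \<partial>N)"
    using int by (intro nn_integral_eq_integral AE_I2) auto
  then show ?thesis using int by (simp add: prob_space)
qed

text \<open>The mean after a jump is compared on both sides with \<open>K\<close> added. Positivity
  of \<theta> and of its jumps makes all gamma products probability measures, so that the
  \<open>K\<close> cancels; then the same \<open>F \<theta>\<close> is subtracted.\<close>

lemma kmp_pair_generator_gamma_product:
  fixes f :: "('v::finite \<Rightarrow> real) \<Rightarrow> real"
  assumes s: "s > 0" and \<theta>: "\<And>k. \<theta> k > 0" and ij: "i \<noteq> j" and f: "bounded_measurable orthant K f"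
  shows "(\<integral>\<zeta>. kmp_pair_generator s i j f \<zeta> \<partial>gamma_product s \<theta>)
       = hidden_pair_generator s i j (\<lambda>\<theta>. \<integral>\<zeta>. f \<zeta> \<partial>gamma_product s \<theta>) \<theta>"
proof -
  let ?\<beta> = "beta_law (2 * s) (2 * s)"
  let ?\<Phi> = "\<lambda>u \<zeta>. \<zeta>(i := u * (\<zeta> i + \<zeta> j), j := (1 - u) * (\<zeta> i + \<zeta> j))"
  let ?\<Psi> = "\<lambda>u \<theta>. \<theta>(i := \<theta> i * u + \<theta> j * (1 - u), j := \<theta> i * u + \<theta> j * (1 - u))"
  define F where "F \<theta> = (\<integral>\<zeta>. f \<zeta> \<partial>gamma_product s \<theta>)" for \<theta>
  have [measurable]: "f \<in> borel_measurable orthant" using f by (simp add: bounded_measurable_def)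
  note \<beta> = prob_space_beta_law[OF s]
  note \<Gamma> = prob_space_gamma_product[OF s, of \<theta>, OF \<theta>]
  have \<theta>_orthant: "\<theta> \<in> space orthant" using \<theta> by (simp add: space_orthant less_imp_le)
  have F: "bounded_measurable orthant K F"
    unfolding F_def[abs_def] by (rule bounded_measurable_gamma_product[OF s f])
  have G: "bounded_measurable orthant K (\<lambda>\<zeta>. \<integral>u. f (?\<Phi> u \<zeta>) \<partial>?\<beta>)"
    by (rule bounded_measurable_integral_pair[OF \<beta> f measurable_kmp_update])
  have H: "bounded_measurable ?\<beta> K (\<lambda>v. F (?\<Psi> v \<theta>))"
    by (rule bounded_measurable_section[OF F measurable_hidden_update \<theta>_orthant])
  have "ennreal ((\<integral>\<zeta>. \<integral>u. f (?\<Phi> u \<zeta>) \<partial>?\<beta> \<partial>gamma_product s \<theta>) + K)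
      = (\<integral>\<^sup>+\<zeta>. ennreal ((\<integral>u. f (?\<Phi> u \<zeta>) \<partial>?\<beta>) + K) \<partial>gamma_product s \<theta>)"
    by (rule nn_integral_bounded_measurable[OF \<Gamma> sets_gamma_product G, symmetric])
  also have "\<dots> = (\<integral>\<^sup>+\<zeta>. \<integral>\<^sup>+u. ennreal (f (?\<Phi> u \<zeta>) + K) \<partial>?\<beta> \<partial>gamma_product s \<theta>)"
    by (intro nn_integral_cong nn_integral_bounded_measurable[OF \<beta> refl, symmetric]
        bounded_measurable_section[OF f measurable_kmp_update]) (simp add: space_gamma_product)
  also have "\<dots> = (\<integral>\<^sup>+v. \<integral>\<^sup>+\<zeta>. ennreal (f \<zeta> + K) \<partial>gamma_product s (?\<Psi> v \<theta>) \<partial>?\<beta>)"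
    by (intro nn_integral_kmp_update_gamma_product[OF s \<theta> ij]) measurable
  also have "\<dots> = (\<integral>\<^sup>+v. ennreal (F (?\<Psi> v \<theta>) + K) \<partial>?\<beta>)"
  proof (rule nn_integral_cong)
    fix v assume "v \<in> space ?\<beta>"
    then have "\<And>k. ?\<Psi> v \<theta> k > 0"
      using convex_combination_pos[OF \<theta> \<theta>, of v i j] \<theta> by (simp add: space_beta_law)
    from nn_integral_bounded_measurable[OF prob_space_gamma_product[OF s, of "?\<Psi> v \<theta>", OF this]
        sets_gamma_product f]
    show "(\<integral>\<^sup>+\<zeta>. ennreal (f \<zeta> + K) \<partial>gamma_product s (?\<Psi> v \<theta>)) = ennreal (F (?\<Psi> v \<theta>) + K)"
      by (simp add: F_def)
  qed
  also have "\<dots> = ennreal ((\<integral>v. F (?\<Psi> v \<theta>) \<partial>?\<beta>) + K)"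
    by (rule nn_integral_bounded_measurable[OF \<beta> refl H])
  \<comment> \<open>\<open>ennreal\<close> is injective only on nonnegative reals; both integrals
    are at least \<open>- K\<close>.\<close>
  finally have "(\<integral>\<zeta>. \<integral>u. f (?\<Phi> u \<zeta>) \<partial>?\<beta> \<partial>gamma_product s \<theta>) + K = (\<integral>v. F (?\<Psi> v \<theta>) \<partial>?\<beta>) + K"
    using bounded_measurable_integral(2)[OF prob_space_imp_subprob_space[OF \<Gamma>] sets_gamma_product G]
      bounded_measurable_integral(2)[OF prob_space_imp_subprob_space[OF \<beta>] refl H]
    by (subst (asm) ennreal_inj) (auto simp: abs_le_iff)
  moreover have "(\<integral>\<zeta>. kmp_pair_generator s i j f \<zeta> \<partial>gamma_product s \<theta>)
      = (\<integral>\<zeta>. (\<integral>u. f (?\<Phi> u \<zeta>) \<partial>?\<beta>) - f \<zeta> \<partial>gamma_product s \<theta>)"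
    unfolding kmp_pair_generator_def
    by (intro Bochner_Integration.integral_cong refl pair_generator_eq[OF \<beta> f measurable_kmp_update])
       (simp add: space_gamma_product)
  moreover have "\<dots> = (\<integral>\<zeta>. \<integral>u. f (?\<Phi> u \<zeta>) \<partial>?\<beta> \<partial>gamma_product s \<theta>) - F \<theta>"
    unfolding F_def
    by (rule Bochner_Integration.integral_diff[OF
          bounded_measurable_integral(1)[OF prob_space_imp_subprob_space[OF \<Gamma>] sets_gamma_product G]
          bounded_measurable_integral(1)[OF prob_space_imp_subprob_space[OF \<Gamma>] sets_gamma_product f]])
  moreover have "hidden_pair_generator s i j F \<theta> = (\<integral>v. F (?\<Psi> v \<theta>) \<partial>?\<beta>) - F \<theta>"
    unfolding hidden_pair_generator_def
    by (rule pair_generator_eq[OF \<beta> F measurable_hidden_update \<theta>_orthant])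
  ultimately show ?thesis by (simp add: F_def[abs_def])
qed

section \<open>Full generators and their iterates\<close>

lemma kmp_generator_gamma_product:
  fixes f :: "('v::finite \<Rightarrow> real) \<Rightarrow> real"
  assumes s: "s > 0" and \<theta>: "\<And>k. \<theta> k > 0" and f: "bounded_measurable orthant K f"
  shows "(\<integral>\<zeta>. kmp_generator s p f \<zeta> \<partial>gamma_product s \<theta>)
       = hidden_generator s p (\<lambda>\<theta>. \<integral>\<zeta>. f \<zeta> \<partial>gamma_product s \<theta>) \<theta>"
proof -
  have "integrable (gamma_product s \<theta>) (kmp_pair_generator s i j f)" for i j
    by (rule bounded_measurable_integral(1)[OF prob_space_imp_subprob_space sets_gamma_product
          bounded_measurable_kmp_pair_generator[OF s f]]) (rule prob_space_gamma_product[OF s \<theta>])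
  then show ?thesis
    unfolding kmp_generator_def hidden_generator_def
    using kmp_pair_generator_gamma_product[OF s \<theta> _ f] by simp
qed

text \<open>The generator evaluates its argument at \<theta> and at points one jump away, all of
  them positive. Thus equality inside the orthant can be iterated although the functions may differ
  on the boundary.\<close>

lemma hidden_generator_cong_positive:
  assumes "\<And>\<theta>. (\<And>k. \<theta> k > 0) \<Longrightarrow> F \<theta> = G \<theta>" and \<theta>: "\<And>k. \<theta> k > 0"
  shows "hidden_generator s p F \<theta> = hidden_generator s p G \<theta>"
proof -
  have "hidden_pair_generator s i j F \<theta> = hidden_pair_generator s i j G \<theta>" for i j
    unfolding hidden_pair_generator_def
  proof (intro Bochner_Integration.integral_cong refl)
    fix u assume "u \<in> space (beta_law (2 * s) (2 * s))"
    then have "\<And>k. (\<theta>(i := \<theta> i * u + \<theta> j * (1 - u), j := \<theta> i * u + \<theta> j * (1 - u))) k > 0"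
      using convex_combination_pos[OF \<theta> \<theta>, of u i j] \<theta> by (simp add: space_beta_law)
    then show "F (\<theta>(i := \<theta> i * u + \<theta> j * (1 - u), j := \<theta> i * u + \<theta> j * (1 - u))) - F \<theta>
        = G (\<theta>(i := \<theta> i * u + \<theta> j * (1 - u), j := \<theta> i * u + \<theta> j * (1 - u))) - G \<theta>"
      using assms by simp
  qed
  then show ?thesis by (simp add: hidden_generator_def)
qed

lemma kmp_generator_funpow_gamma_product:
  fixes f :: "('v::finite \<Rightarrow> real) \<Rightarrow> real"
  assumes s: "s > 0" and p: "\<And>i j. p i j \<ge> 0" and f: "bounded_measurable orthant K f"
    and "\<And>k. \<theta> k > 0"
  shows "(\<integral>\<zeta>. (kmp_generator s p ^^ n) f \<zeta> \<partial>gamma_product s \<theta>)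
       = (hidden_generator s p ^^ n) (\<lambda>\<theta>. \<integral>\<zeta>. f \<zeta> \<partial>gamma_product s \<theta>) \<theta>"
  using assms(4)
\<comment> \<open>The hidden generator evaluates the induction hypothesis at the points after a
  jump, so \<theta> must vary.\<close>
proof (induction n arbitrary: \<theta>)
  case (Suc n)
  define C where "C = (\<Sum>i\<in>UNIV. \<Sum>j\<in>UNIV - {i}. 2 * p i j)"
  have "bounded_measurable orthant (C ^ n * K) ((kmp_generator s p ^^ n) f)"
  proof (induction n)
    case (Suc n)
    then show ?case
      using bounded_measurable_kmp_generator[where p = p, OF s p] by (simp add: C_def mult.assoc)
  qed (use f in simp)
  from kmp_generator_gamma_product[OF s Suc.prems this]
  have "(\<integral>\<zeta>. (kmp_generator s p ^^ Suc n) f \<zeta> \<partial>gamma_product s \<theta>)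
      = hidden_generator s p (\<lambda>\<theta>. \<integral>\<zeta>. (kmp_generator s p ^^ n) f \<zeta> \<partial>gamma_product s \<theta>) \<theta>"
    by simp
  also have "\<dots> = hidden_generator s p
      ((hidden_generator s p ^^ n) (\<lambda>\<theta>. \<integral>\<zeta>. f \<zeta> \<partial>gamma_product s \<theta>)) \<theta>"
    by (rule hidden_generator_cong_positive) (use Suc in auto)
  finally show ?case by simp
qed simp

section \<open>Intertwining of the semigroups\<close>

text \<open>Only the Markov property from time 0 is used: integrating the conditional expectation
  removes the conditioning, and \<open>P t (X 0 \<omega>)\<close> is almost surely
  \<open>P t x\<close>.\<close>

lemma measure_markov_process:
  assumes X: "markov_process M E P X" and start: "AE \<omega> in M. X 0 \<omega> = x"
    and "t \<ge> 0" and A: "A \<in> sets E"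
  shows "measure M (X t -` A \<inter> space M) = measure (P t x) A"
proof -
  interpret prob_space M using X by (simp add: markov_process_def)
  let ?F = "natural_filtration M E X 0"
  have meas: "X q \<in> M \<rightarrow>\<^sub>M E" if "q \<ge> 0" for q
    using X that by (simp add: markov_process_def)
  have "subalgebra M ?F"
    unfolding subalgebra_def natural_filtration_def
  proof (intro conjI)
    show "space (sigma (space M) {X q -` B \<inter> space M |q B. 0 \<le> q \<and> q \<le> 0 \<and> B \<in> sets E}) = space M"
      by (rule space_measure_of) auto
    show "sets (sigma (space M) {X q -` B \<inter> space M |q B. 0 \<le> q \<and> q \<le> 0 \<and> B \<in> sets E}) \<subseteq> sets M"
      using measurable_sets[OF meas]
      by (subst sets_measure_of) (auto intro!: sets.sigma_sets_subset)
  qed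
  then interpret finite_measure_subalgebra M ?F by unfold_locales
  note Xt [measurable] = meas[OF \<open>t \<ge> 0\<close>]
  note A [measurable]
  have int: "integrable M (\<lambda>\<omega>. indicator A (X t \<omega>) :: real)"
    by (rule integrable_const_bound[where B = 1]) auto
  have "measure M (X t -` A \<inter> space M) = (\<integral>\<omega>. indicator (X t -` A \<inter> space M) \<omega> \<partial>M)"
    by simp
  also have "\<dots> = (\<integral>\<omega>. indicator A (X t \<omega>) \<partial>M)"
    by (intro Bochner_Integration.integral_cong) (auto simp: indicator_def)
  also have "\<dots> = (\<integral>\<omega>. real_cond_exp M ?F (\<lambda>\<omega>. indicator A (X t \<omega>)) \<omega> \<partial>M)"
    by (rule real_cond_exp_int(2)[OF int, symmetric])
  also have "\<dots> = (\<integral>\<omega>. measure (P t x) A \<partial>M)"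
  proof (rule integral_cong_AE)
    have "AE \<omega> in M. real_cond_exp M ?F (\<lambda>\<omega>'. indicator A (X (0 + t) \<omega>')) \<omega> = measure (P t (X 0 \<omega>)) A"
      using X \<open>t \<ge> 0\<close> A unfolding markov_process_def by blast
    with start show "AE \<omega> in M. real_cond_exp M ?F (\<lambda>\<omega>. indicator A (X t \<omega>)) \<omega> = measure (P t x) A"
      by eventually_elim simp
  qed auto
  finally show ?thesis by (simp add: prob_space)
qed

lemma distr_markov_process:
  assumes X: "markov_process M E P X" and P: "markov_semigroup E P"
    and start: "AE \<omega> in M. X 0 \<omega> = x" and x: "x \<in> space E" and t: "t \<ge> 0"
  shows "distr M E (X t) = P t x"
proof (rule measure_eqI)
  interpret prob_space M using X by (simp add: markov_process_def)
  have Xt: "X t \<in> M \<rightarrow>\<^sub>M E" using X t by (simp add: markov_process_def)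
  have "P t x \<in> space (prob_algebra E)"
    using P t x by (intro measurable_space[of "P t" E]) (auto simp: markov_semigroup_def)
  then have sets: "sets (P t x) = sets E" and Pt: "prob_space (P t x)"
    by (simp_all add: space_prob_algebra)
  show "sets (distr M E (X t)) = sets (P t x)" using sets by simp
  fix A assume "A \<in> sets (distr M E (X t))"
  then have A: "A \<in> sets E" by simp
  interpret Pt: prob_space "P t x" by (rule Pt)
  show "emeasure (distr M E (X t)) A = emeasure (P t x) A"
    using measure_markov_process[OF X start t A]
    by (simp add: emeasure_distr[OF Xt A] emeasure_eq_measure Pt.emeasure_eq_measure)
qed

text \<open>Up to the factor \<open>B * t * K\<close> these are the terms of the exponential series
  at \<open>B * t\<close>.\<close>

lemma taylor_remainder_tendsto_0:
  fixes B t K :: real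
  shows "(\<lambda>n. B ^ Suc n * K * t ^ Suc n / fact n) \<longlonglongrightarrow> 0"
proof -
  have "summable (\<lambda>n. (B * t) ^ n / fact n)"
    using summable_exp[of "B * t"] by (simp add: field_simps)
  from tendsto_mult_left[OF summable_LIMSEQ_zero[OF this], of "B * t * K"] show ?thesis
    by (simp add: power_mult_distrib mult_ac)
qed

text \<open>The Taylor bound for \<open>S\<close> is uniform in \<zeta>, so it survives integration
  against the gamma product. The one for \<open>Q\<close> is read at \<theta> alone, where the two
  Taylor polynomials coincide.\<close>

lemma intertwined_semigroups:
  fixes f :: "('v::finite \<Rightarrow> real) \<Rightarrow> real"
  assumes s: "s > 0" and p: "\<And>i j. p i j \<ge> 0"
    and S: "markov_semigroup orthant S" "has_generator orthant S (kmp_generator s p)"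
    and Q: "markov_semigroup orthant Q" "has_generator orthant Q (hidden_generator s p)"
    and \<theta>: "\<And>i. \<theta> i > 0" and t: "t \<ge> 0" and f: "bounded_measurable orthant K f"
  shows "(\<integral>\<zeta>. \<integral>\<eta>. f \<eta> \<partial>S t \<zeta> \<partial>gamma_product s \<theta>)
       = (\<integral>\<theta>'. \<integral>\<zeta>. f \<zeta> \<partial>gamma_product s \<theta>' \<partial>Q t \<theta>)"
proof -
  define C where "C = (\<Sum>i\<in>UNIV. \<Sum>j\<in>UNIV - {i}. 2 * p i j)"
  define F where "F \<theta> = (\<integral>\<zeta>. f \<zeta> \<partial>gamma_product s \<theta>)" for \<theta>
  let ?L = "kmp_generator s p"
  let ?H = "hidden_generator s p"
  interpret S: generated_semigroup orthant S ?L C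
    unfolding C_def
    by (intro generated_semigroup.intro S bounded_measurable_kmp_generator s p)
  interpret Q: generated_semigroup orthant Q ?H C
    unfolding C_def
    by (intro generated_semigroup.intro Q bounded_measurable_hidden_generator s p)
  have F: "bounded_measurable orthant K F"
    unfolding F_def[abs_def] by (rule bounded_measurable_gamma_product[OF s f])
  have \<theta>_orthant: "\<theta> \<in> space orthant" using \<theta> by (simp add: space_orthant less_imp_le)
  note \<Gamma> = prob_space_imp_subprob_space[OF prob_space_gamma_product[OF s, of \<theta>, OF \<theta>]]
  let ?a = "\<integral>\<zeta>. \<integral>\<eta>. f \<eta> \<partial>S t \<zeta> \<partial>gamma_product s \<theta>"
  let ?b = "\<integral>\<theta>'. F \<theta>' \<partial>Q t \<theta>"
  \<comment> \<open>The factor 2 counts one remainder for each semigroup.\<close>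
  have remainder: "\<bar>?a - ?b\<bar> \<le> 2 * (C ^ Suc n * K * t ^ Suc n / fact n)" for n
  proof -
    let ?T = "\<lambda>\<zeta>. \<Sum>i\<le>n. (?L ^^ i) f \<zeta> * t ^ i / fact i"
    have int_L: "integrable (gamma_product s \<theta>) (\<lambda>\<zeta>. (?L ^^ i) f \<zeta> * t ^ i / fact i)" for i
      using bounded_measurable_integral(1)[OF \<Gamma> sets_gamma_product S.bounded_measurable_funpow[OF f]]
      by simp
    have int_S: "integrable (gamma_product s \<theta>) (\<lambda>\<zeta>. \<integral>\<eta>. f \<eta> \<partial>S t \<zeta>)"
      by (rule bounded_measurable_integral(1)[OF \<Gamma> sets_gamma_product S.bounded_measurable_kernel[OF t f]])
    have "bounded_measurable orthant (C ^ Suc n * K * t ^ Suc n / fact n) (\<lambda>\<zeta>. (\<integral>\<eta>. f \<eta> \<partial>S t \<zeta>) - ?T \<zeta>)"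
      unfolding bounded_measurable_def
    proof (intro conjI ballI)
      have [measurable]: "(?L ^^ i) f \<in> borel_measurable orthant"
        "(\<lambda>\<zeta>. \<integral>\<eta>. f \<eta> \<partial>S t \<zeta>) \<in> borel_measurable orthant" for i
        using S.bounded_measurable_funpow[OF f] S.bounded_measurable_kernel[OF t f]
        by (auto simp: bounded_measurable_def)
      show "(\<lambda>\<zeta>. (\<integral>\<eta>. f \<eta> \<partial>S t \<zeta>) - ?T \<zeta>) \<in> borel_measurable orthant"
        by measurable
    qed (rule S.kernel_taylor[OF f t])
    from bounded_measurable_integral(2)[OF \<Gamma> sets_gamma_product this]
    have "\<bar>?a - (\<integral>\<zeta>. ?T \<zeta> \<partial>gamma_product s \<theta>)\<bar> \<le> C ^ Suc n * K * t ^ Suc n / fact n"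
      by (simp only: Bochner_Integration.integral_diff[OF int_S Bochner_Integration.integrable_sum[OF int_L]])
    moreover have "(\<integral>\<zeta>. ?T \<zeta> \<partial>gamma_product s \<theta>) = (\<Sum>i\<le>n. (?H ^^ i) F \<theta> * t ^ i / fact i)"
      using int_L kmp_generator_funpow_gamma_product[where p = p, OF s p f \<theta>]
      by (simp add: F_def[abs_def])
    moreover have "\<bar>?b - (\<Sum>i\<le>n. (?H ^^ i) F \<theta> * t ^ i / fact i)\<bar> \<le> C ^ Suc n * K * t ^ Suc n / fact n"
      by (rule Q.kernel_taylor[OF F t \<theta>_orthant])
    ultimately show ?thesis by linarith
  qed
  have "\<bar>?a - ?b\<bar> \<le> 2 * 0"
    by (rule tendsto_lowerbound[OF tendsto_mult_left[OF taylor_remainder_tendsto_0[of C K t]]],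
        intro always_eventually allI remainder) simp
  then show ?thesis by (simp add: F_def)
qed

theorem theorem2p2:
  fixes s t :: real
    and p :: "'v::finite \<Rightarrow> 'v \<Rightarrow> real"
    and S Q :: "real \<Rightarrow> ('v \<Rightarrow> real) \<Rightarrow> ('v \<Rightarrow> real) measure"
    and \<theta> :: "'v \<Rightarrow> real"
    and M :: "'w measure"
    and X :: "real \<Rightarrow> 'w \<Rightarrow> 'v \<Rightarrow> real"
    and A :: "('v \<Rightarrow> real) set"
  assumes s_pos: "s > 0"
    and p_sym: "\<And>i j. p i j = p j i"
    and p_nonneg: "\<And>i j. p i j \<ge> 0"
    and p_irreducible: "irreducible_weights p"
    and S_semigroup: "markov_semigroup orthant S"
    and S_generator: "has_generator orthant S (kmp_generator s p)"
    and Q_semigroup: "markov_semigroup orthant Q"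
    and Q_generator: "has_generator orthant Q (hidden_generator s p)"
    and theta_pos: "\<And>i. \<theta> i > 0"
    and X_markov: "markov_process M orthant Q X"
    and X_start: "AE \<omega> in M. X 0 \<omega> = \<theta>"
    and t_pos: "t > 0"
    and A_meas: "A \<in> sets orthant"
  shows "emeasure (gamma_product s \<theta> \<bind> S t) A
           = (\<integral>\<^sup>+ \<omega>. emeasure (gamma_product s (X t \<omega>)) A \<partial>M)"
proof -
  have \<theta>_orthant: "\<theta> \<in> space orthant"
    using theta_pos by (simp add: space_orthant less_imp_le)
  have t: "t \<ge> 0" using t_pos by simp
  have S: "S t \<in> orthant \<rightarrow>\<^sub>M subprob_algebra orthant"
    using S_semigroup t by (simp add: markov_semigroup_def measurable_prob_algebraD)
  have Qt: "prob_space (Q t \<theta>)" "sets (Q t \<theta>) = sets orthant"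
    using Q_semigroup t \<theta>_orthant measurable_space[of "Q t" orthant "prob_algebra orthant" \<theta>]
    by (simp_all add: markov_semigroup_def space_prob_algebra)
  note G = measurable_gamma_product[OF s_pos, where 'v = 'v]
  note \<Gamma> = prob_space_gamma_product[OF s_pos, of \<theta>, OF theta_pos]
  \<comment> \<open>The identity of measures is tested on the indicator of \<open>A\<close>, with
    \<open>K = 1\<close>.\<close>
  have A: "bounded_measurable orthant 1 (indicat_real A)"
    using A_meas by (auto simp: bounded_measurable_def)
  have emeasure_eq: "emeasure N A = ennreal (\<integral>\<zeta>. indicat_real A \<zeta> \<partial>N)"
    if "N \<in> space (subprob_algebra orthant)" for N
  proof -
    interpret subprob_space N using that by (simp add: space_subprob_algebra)
    have "A \<in> sets N" using that A_meas by (simp add: space_subprob_algebra)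
    then show ?thesis by (simp add: emeasure_eq_measure)
  qed
  \<comment> \<open>Used for \<open>S t\<close> under the gamma product and for the gamma product
    under \<open>Q t \<theta>\<close>. The second kernel is only a subprobability kernel, which
    fixes the generality of \<open>P\<close>.\<close>
  have kernel_integral: "(\<integral>\<^sup>+x. emeasure (P x) A \<partial>N) = ennreal (\<integral>x. \<integral>\<zeta>. indicat_real A \<zeta> \<partial>P x \<partial>N)"
    if P: "P \<in> orthant \<rightarrow>\<^sub>M subprob_algebra orthant" and N: "prob_space N" "sets N = sets orthant"
    for P :: "('v \<Rightarrow> real) \<Rightarrow> ('v \<Rightarrow> real) measure" and N
  proof -
    interpret N: prob_space N by (rule N)
    have space: "space N = space orthant" using N(2) by (rule sets_eq_imp_space_eq)
    have "bounded_measurable orthant 1 (\<lambda>x. \<integral>\<zeta>. indicat_real A \<zeta> \<partial>P x)"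
      unfolding bounded_measurable_def
    proof (intro conjI ballI)
      note [measurable] = A_meas P
      show "(\<lambda>x. \<integral>\<zeta>. indicat_real A \<zeta> \<partial>P x) \<in> borel_measurable orthant" by measurable
      fix x :: "'v \<Rightarrow> real" assume "x \<in> space orthant"
      then have "P x \<in> space (subprob_algebra orthant)" by (rule measurable_space[OF P])
      then show "\<bar>\<integral>\<zeta>. indicat_real A \<zeta> \<partial>P x\<bar> \<le> 1"
        using A by (intro bounded_measurable_integral(2)) (simp_all add: space_subprob_algebra)
    qed
    note int = bounded_measurable_integral(1)[OF prob_space_imp_subprob_space[OF N(1)] N(2) this]
    have "(\<integral>\<^sup>+x. emeasure (P x) A \<partial>N) = (\<integral>\<^sup>+x. ennreal (\<integral>\<zeta>. indicat_real A \<zeta> \<partial>P x) \<partial>N)"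
      using emeasure_eq measurable_space[OF P] by (intro nn_integral_cong) (simp add: space)
    also have "\<dots> = ennreal (\<integral>x. \<integral>\<zeta>. indicat_real A \<zeta> \<partial>P x \<partial>N)"
      by (intro nn_integral_eq_integral int AE_I2) simp
    finally show ?thesis .
  qed
  have "emeasure (gamma_product s \<theta> \<bind> S t) A = (\<integral>\<^sup>+\<zeta>. emeasure (S t \<zeta>) A \<partial>gamma_product s \<theta>)"
    using S A_meas prob_space.not_empty[OF \<Gamma>]
    by (intro emeasure_bind) (simp_all add: measurable_cong_sets[OF sets_gamma_product refl])
  also have "\<dots> = ennreal (\<integral>\<zeta>. \<integral>\<eta>. indicat_real A \<eta> \<partial>S t \<zeta> \<partial>gamma_product s \<theta>)"
    by (rule kernel_integral[OF S \<Gamma> sets_gamma_product])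
  also have "\<dots> = ennreal (\<integral>\<theta>'. \<integral>\<zeta>. indicat_real A \<zeta> \<partial>gamma_product s \<theta>' \<partial>Q t \<theta>)"
    by (simp only: intertwined_semigroups[OF s_pos p_nonneg S_semigroup S_generator
          Q_semigroup Q_generator theta_pos t A])
  also have "\<dots> = (\<integral>\<^sup>+\<theta>'. emeasure (gamma_product s \<theta>') A \<partial>Q t \<theta>)"
    by (rule kernel_integral[OF G Qt, symmetric])
  \<comment> \<open>The kernel \<open>Q t \<theta>\<close> is the law of \<open>X t\<close>, which
    turns the integral into an expectation over \<open>M\<close>.\<close>
  also have "\<dots> = (\<integral>\<^sup>+\<theta>'. emeasure (gamma_product s \<theta>') A \<partial>distr M orthant (X t))"
    by (simp only: distr_markov_process[OF X_markov Q_semigroup X_start \<theta>_orthant t])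
  also have "\<dots> = (\<integral>\<^sup>+\<omega>. emeasure (gamma_product s (X t \<omega>)) A \<partial>M)"
    using X_markov t measurable_emeasure_kernel[OF G A_meas]
    by (intro nn_integral_distr) (simp_all add: markov_process_def)
  finally show ?thesis .
qed

end
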